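(* There exist universal constants $c_0>0$ and $d_0\in\mathbb N$ such that the following holds. Let $d\ge d_0$, $R,\beta_0>0$, and let $m$ be an integer satisfying $$1\le m\le\frac d4,\qquad m^3\log(ed)\le c_0d.$$ For every deterministic adaptive algorithm making fewer than $dm/8$ exact-value calls in $X=B_2^d(R)$, there exists one fixed function $F\in\mathcal G_{\beta_0}(d,R)$ such that the output $\widehat x$ of the algorithm run on $F$ satisfies $$F(\widehat x)-F^\star\ge 2^{-17}\frac{\beta_0R^2}{m^2},$$ where $F^\star=\min_{\mathbb R^d}F$. Moreover, the largest strong-convexity modulus of $F$ is exactly $$\mu(F)=\frac{\beta_0}{4096m^2}.$$
   Context: $B_2^d(r)$ is the closed Euclidean ball of radius $r$ centred at $0$ in $\mathbb R^d$; $X:=B_2^d(R)$. Class $\mathcal G_L(d,R)$ for $L>0$: all convex, continuously differentiable $f:\mathbb R^d\to\mathbb R$ whose gradient is globally $L$-Lipschitz in Euclidean norm and which have a unique global minimizer, lying in $B_2^d(R/2)$. A deterministic adaptive algorithm with budget $T$ (making $T$ calls) consists of Borel maps $Q_t:(X\times\mathbb R)^{t-1}\to X$, $t=1,\dots,T$, and a Borel terminal map $Q_{\mathrm{out}}:(X\times\mathbb R)^T\to X$. On a fixed objective $f$ it generates recursively $x_t=Q_t((x_1,f(x_1)),\dots,(x_{t-1},f(x_{t-1})))$ and outputs $\widehat x=Q_{\mathrm{out}}((x_1,f(x_1)),\dots,(x_T,f(x_T)))$. The largest strong-convexity modulus $\mu(F)$ is the largest $\mu\ge0$ such that $F(y)\ge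 F(x)+\langle\nabla F(x),y-x\rangle+\frac\mu2\|y-x\|_2^2$ for all $x,y\in\mathbb R^d$. *)

theory Defs
  imports "HOL-Analysis.Analysis"
begin

text \<open>
  The dimension is quantified inside the theorem, below the universal constants, so
  \<open>\<real>\<^sup>d\<close> is the carrier of the library's \<^const>\<open>Euclidean_space\<close>: sequences vanishing from
  index \<open>d\<close> on, with the product topology. Objective functions have type
  \<open>(nat \<Rightarrow> real) \<Rightarrow> real\<close>; only their values on this carrier are ever used.
\<close>

abbreviation Rd :: "nat \<Rightarrow> (nat \<Rightarrow> real) set"
  where "Rd d \<equiv> topspace (Euclidean_space d)"

definition inner_d :: "nat \<Rightarrow> (nat \<Rightarrow> real) \<Rightarrow> (nat \<Rightarrow> real) \<Rightarrow> real"
  where "inner_d d x y = (\<Sum>i<d. x i * y i)"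

definition norm_d :: "nat \<Rightarrow> (nat \<Rightarrow> real) \<Rightarrow> real"
  where "norm_d d x = L2_set x {..<d}"

definition ball_d :: "nat \<Rightarrow> real \<Rightarrow> (nat \<Rightarrow> real) set"
  where "ball_d d r = {x \<in> Rd d. norm_d d x \<le> r}"

definition convex_d :: "nat \<Rightarrow> ((nat \<Rightarrow> real) \<Rightarrow> real) \<Rightarrow> bool"
  where "convex_d d f \<longleftrightarrow>
    (\<forall>x\<in>Rd d. \<forall>y\<in>Rd d. \<forall>t\<in>{0..1}.
       f (\<lambda>i. (1 - t) * x i + t * y i) \<le> (1 - t) * f x + t * f y)"

text \<open>Frechet differentiability at \<open>x\<close>, with the derivative represented by the vector \<open>g\<close>.\<close>

definition has_gradient :: "nat \<Rightarrow> ((nat \<Rightarrow> real) \<Rightarrow> real) \<Rightarrow> (nat \<Rightarrow> real) \<Rightarrow> (nat \<Rightarrow> real) \<Rightarrow> bool"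
  where "has_gradient d f g x \<longleftrightarrow> g \<in> Rd d \<and>
    ((\<lambda>y. (f y - f x - inner_d d g (\<lambda>i. y i - x i)) / norm_d d (\<lambda>i. y i - x i))
       \<longlongrightarrow> 0) (atin (Euclidean_space d) x)"

definition gradient :: "nat \<Rightarrow> ((nat \<Rightarrow> real) \<Rightarrow> real) \<Rightarrow> (nat \<Rightarrow> real) \<Rightarrow> (nat \<Rightarrow> real)"
  where "gradient d f x = (THE g. has_gradient d f g x)"

definition global_minimizer :: "nat \<Rightarrow> ((nat \<Rightarrow> real) \<Rightarrow> real) \<Rightarrow> (nat \<Rightarrow> real) \<Rightarrow> bool"
  where "global_minimizer d f z \<longleftrightarrow> z \<in> Rd d \<and> (\<forall>y\<in>Rd d. f z \<le> f y)"

definition smooth_class :: "real \<Rightarrow> nat \<Rightarrow> real \<Rightarrow> ((nat \<Rightarrow> real) \<Rightarrow> real) set"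
  where "smooth_class L d R =
    {f. convex_d d f \<and>
        (\<forall>x\<in>Rd d. has_gradient d f (gradient d f x) x) \<and>
        continuous_map (Euclidean_space d) (Euclidean_space d) (gradient d f) \<and>
        (\<forall>x\<in>Rd d. \<forall>y\<in>Rd d.
           norm_d d (\<lambda>i. gradient d f x i - gradient d f y i) \<le> L * norm_d d (\<lambda>i. x i - y i)) \<and>
        (\<exists>!z. global_minimizer d f z) \<and>
        (\<forall>z. global_minimizer d f z \<longrightarrow> z \<in> ball_d d (R / 2))}"

text \<open>
  For an \<open>f\<close> with a global minimizer, as for every member of \<^const>\<open>smooth_class\<close>, this
  infimum is attained and is the minimum of \<open>f\<close>.
\<close>

definition min_value :: "nat \<Rightarrow> ((nat \<Rightarrow> real) \<Rightarrow> real) \<Rightarrow> real"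
  where "min_value d f = (INF x\<in>Rd d. f x)"

definition strong_convexity_moduli :: "nat \<Rightarrow> ((nat \<Rightarrow> real) \<Rightarrow> real) \<Rightarrow> real set"
  where "strong_convexity_moduli d f =
    {\<mu>. 0 \<le> \<mu> \<and>
        (\<forall>x\<in>Rd d. \<forall>y\<in>Rd d.
           f y \<ge> f x + inner_d d (gradient d f x) (\<lambda>i. y i - x i)
                 + \<mu> / 2 * (norm_d d (\<lambda>i. y i - x i))\<^sup>2)}"

definition is_largest_strong_convexity_modulus :: "nat \<Rightarrow> ((nat \<Rightarrow> real) \<Rightarrow> real) \<Rightarrow> real \<Rightarrow> bool"
  where "is_largest_strong_convexity_modulus d f \<mu> \<longleftrightarrow>
    \<mu> \<in> strong_convexity_moduli d f \<and> (\<forall>\<nu>\<in>strong_convexity_moduli d f. \<nu> \<le> \<mu>)"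

text \<open>
  Calls are numbered from 0. A history of \<open>t\<close> calls is an element of \<open>(X \<times> \<real>)\<^sup>t\<close>, i.e. a
  function on \<open>{..<t}\<close> that is \<^const>\<open>undefined\<close> elsewhere, as in the space of a
  \<^const>\<open>PiM\<close> product. The map \<open>Q t\<close> for \<open>t < T\<close> chooses the next query after \<open>t\<close> calls;
  \<open>Qout\<close> is the terminal map.
\<close>

definition query_space :: "nat \<Rightarrow> real \<Rightarrow> (nat \<Rightarrow> real) measure"
  where "query_space d R = restrict_space borel (ball_d d R)"

definition history_space :: "nat \<Rightarrow> real \<Rightarrow> nat \<Rightarrow> (nat \<Rightarrow> (nat \<Rightarrow> real) \<times> real) measure"
  where "history_space d R t = PiM {..<t} (\<lambda>_. query_space d R \<Otimes>\<^sub>M borel)"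

definition algorithm ::
  "nat \<Rightarrow> real \<Rightarrow> nat \<Rightarrow> (nat \<Rightarrow> (nat \<Rightarrow> (nat \<Rightarrow> real) \<times> real) \<Rightarrow> (nat \<Rightarrow> real))
     \<Rightarrow> ((nat \<Rightarrow> (nat \<Rightarrow> real) \<times> real) \<Rightarrow> (nat \<Rightarrow> real)) \<Rightarrow> bool"
  where "algorithm d R T Q Qout \<longleftrightarrow>
    (\<forall>t<T. Q t \<in> history_space d R t \<rightarrow>\<^sub>M query_space d R) \<and>
    Qout \<in> history_space d R T \<rightarrow>\<^sub>M query_space d R"

primrec history ::
  "(nat \<Rightarrow> (nat \<Rightarrow> (nat \<Rightarrow> real) \<times> real) \<Rightarrow> (nat \<Rightarrow> real)) \<Rightarrow> ((nat \<Rightarrow> real) \<Rightarrow> real)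
     \<Rightarrow> nat \<Rightarrow> (nat \<Rightarrow> (nat \<Rightarrow> real) \<times> real)"
  where
    "history Q f 0 = (\<lambda>_. undefined)"
  | "history Q f (Suc t) =
       (history Q f t)(t := (Q t (history Q f t), f (Q t (history Q f t))))"

definition algorithm_output ::
  "nat \<Rightarrow> (nat \<Rightarrow> (nat \<Rightarrow> (nat \<Rightarrow> real) \<times> real) \<Rightarrow> (nat \<Rightarrow> real))
     \<Rightarrow> ((nat \<Rightarrow> (nat \<Rightarrow> real) \<times> real) \<Rightarrow> (nat \<Rightarrow> real))
     \<Rightarrow> ((nat \<Rightarrow> real) \<Rightarrow> real) \<Rightarrow> (nat \<Rightarrow> real)"
  where "algorithm_output T Q Qout f = Qout (history Q f T)"

end

theory Submission
  imports Defs
begin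

text \<open>The hard function is \<open>F(x) = (\<beta> \<eta> / 2) \<phi>((\<langle>v\<^sub>j, x\<rangle> - 2 \<eta> j)\<^sub>j\<^sub><\<^sub>m) + (\<mu> / 2) \<bar>x\<bar>\<^sup>2\<close>, where \<open>\<phi>\<close> is the
  Moreau smoothing of the maximum at scale \<open>\<eta>\<close> and the \<open>v\<^sub>j\<close> are orthonormal. An entry lying \<open>\<eta>\<close>
  below another one does not influence \<open>\<phi>\<close>, so a query orthogonal to \<open>v\<^sub>p\<close> that has products at most
  \<open>\<eta>\<close> with all later \<open>v\<^sub>j\<close> reveals nothing about these. An adversary therefore fixes one vector per
  \<open>d / 8\<close> queries, orthogonal to the latest queries and (by a random choice of signs, which is where
  \<open>m\<^sup>3 log(ed) \<lesssim> d\<close> enters) almost orthogonal to all earlier ones. In the end the output is orthogonal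
  to some \<open>v\<^sub>k\<close>, hence far from optimal.\<close>

section \<open>Coordinate vectors\<close>

lemma inner_d_comm: "inner_d d x y = inner_d d y x"
  by (simp add: inner_d_def mult.commute)

lemma inner_d_add_left: "inner_d d (\<lambda>i. x i + y i) z = inner_d d x z + inner_d d y z"
  and inner_d_add_right: "inner_d d z (\<lambda>i. x i + y i) = inner_d d z x + inner_d d z y"
  and inner_d_diff_left: "inner_d d (\<lambda>i. x i - y i) z = inner_d d x z - inner_d d y z"
  and inner_d_diff_right: "inner_d d z (\<lambda>i. x i - y i) = inner_d d z x - inner_d d z y"
  by (simp_all add: inner_d_def algebra_simps sum.distrib sum_subtractf)

lemma inner_d_scale_left: "inner_d d (\<lambda>i. c * x i) y = c * inner_d d x y"
  and inner_d_scale_right: "inner_d d y (\<lambda>i. c * x i) = c * inner_d d y x"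
  by (simp_all add: inner_d_def sum_distrib_left mult_ac)

lemma inner_d_sum_left: "inner_d d (\<lambda>i. \<Sum>j\<in>J. c j * v j i) x = (\<Sum>j\<in>J. c j * inner_d d (v j) x)"
proof -
  have "inner_d d (\<lambda>i. \<Sum>j\<in>J. c j * v j i) x = (\<Sum>i<d. \<Sum>j\<in>J. c j * v j i * x i)"
    by (simp add: inner_d_def sum_distrib_right)
  also have "\<dots> = (\<Sum>j\<in>J. \<Sum>i<d. c j * v j i * x i)"
    by (rule sum.swap)
  finally show ?thesis
    by (simp add: inner_d_def sum_distrib_left mult_ac)
qed

lemma inner_d_sum_right: "inner_d d x (\<lambda>i. \<Sum>j\<in>J. c j * v j i) = (\<Sum>j\<in>J. c j * inner_d d x (v j))"
  using inner_d_sum_left[of d c v J x] by (simp add: inner_d_comm)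

lemma inner_d_zero [simp]: "inner_d d (\<lambda>_. 0) x = 0" "inner_d d x (\<lambda>_. 0) = 0"
  by (simp_all add: inner_d_def)

lemma norm_d_nonneg [simp]: "0 \<le> norm_d d x"
  by (simp add: norm_d_def L2_set_nonneg)

lemma norm_d_square: "(norm_d d x)\<^sup>2 = inner_d d x x"
  by (simp add: norm_d_def L2_set_def inner_d_def sum_nonneg power2_eq_square)

lemma inner_d_self_nonneg: "0 \<le> inner_d d x x"
  by (metis norm_d_square zero_le_power2)

lemma norm_d_add: "norm_d d (\<lambda>i. x i + y i) \<le> norm_d d x + norm_d d y"
  unfolding norm_d_def by (rule L2_set_triangle_ineq)

lemma norm_d_scale: "norm_d d (\<lambda>i. c * x i) = \<bar>c\<bar> * norm_d d x"
proof (rule power2_eq_imp_eq)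
  show "(norm_d d (\<lambda>i. c * x i))\<^sup>2 = (\<bar>c\<bar> * norm_d d x)\<^sup>2"
    unfolding power_mult_distrib norm_d_square inner_d_scale_left inner_d_scale_right
    by (simp add: power2_eq_square)
qed simp_all

lemma norm_d_eq_0_iff: "x \<in> Rd d \<Longrightarrow> norm_d d x = 0 \<longleftrightarrow> x = (\<lambda>_. 0)"
  by (auto simp: norm_d_def L2_set_eq_0_iff topspace_Euclidean_space fun_eq_iff not_less[symmetric])

lemma Rd_closed:
  "(\<lambda>_. 0) \<in> Rd d"
  "x \<in> Rd d \<Longrightarrow> y \<in> Rd d \<Longrightarrow> (\<lambda>i. x i + y i) \<in> Rd d"
  "x \<in> Rd d \<Longrightarrow> y \<in> Rd d \<Longrightarrow> (\<lambda>i. x i - y i) \<in> Rd d"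
  "x \<in> Rd d \<Longrightarrow> (\<lambda>i. c * x i) \<in> Rd d"
  "(\<And>j. j \<in> J \<Longrightarrow> v j \<in> Rd d) \<Longrightarrow> (\<lambda>i. \<Sum>j\<in>J. a j * v j i) \<in> Rd d"
  by (simp_all add: topspace_Euclidean_space)

section \<open>Orthonormal families, Bessel's inequality and orthogonal complements\<close>

definition orthonormal_d :: "nat \<Rightarrow> nat \<Rightarrow> (nat \<Rightarrow> nat \<Rightarrow> real) \<Rightarrow> bool"
  where "orthonormal_d d m v \<longleftrightarrow> (\<forall>j<m. v j \<in> Rd d) \<and>
    (\<forall>j<m. \<forall>k<m. inner_d d (v j) (v k) = (if j = k then 1 else 0))"

lemma orthonormal_d_sum:
  assumes "orthonormal_d d m v"
  shows "k < m \<Longrightarrow> inner_d d (v k) (\<lambda>i. \<Sum>j<m. c j * v j i) = c k"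
    and "(norm_d d (\<lambda>i. \<Sum>j<m. c j * v j i))\<^sup>2 = (\<Sum>j<m. (c j)\<^sup>2)"
proof -
  have *: "inner_d d (v k) (\<lambda>i. \<Sum>j<m. c j * v j i) = c k" if "k < m" for k
  proof -
    have "inner_d d (v k) (\<lambda>i. \<Sum>j<m. c j * v j i) = (\<Sum>j<m. if k = j then c j else 0)"
      unfolding inner_d_sum_right
      by (rule sum.cong) (use assms that in \<open>auto simp: orthonormal_d_def\<close>)
    then show ?thesis
      using that by simp
  qed
  then show "k < m \<Longrightarrow> inner_d d (v k) (\<lambda>i. \<Sum>j<m. c j * v j i) = c k" .
  show "(norm_d d (\<lambda>i. \<Sum>j<m. c j * v j i))\<^sup>2 = (\<Sum>j<m. (c j)\<^sup>2)"
    unfolding norm_d_square by (subst inner_d_sum_left) (simp add: * power2_eq_square)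
qed

text \<open>With \<open>p\<close> the projection of \<open>x\<close>, both \<open><p, p>\<close> and
  \<open><p, x>\<close> equal the left-hand side, and \<open>x - p\<close> has nonnegative square
  norm.\<close>

lemma bessel_d:
  assumes "orthonormal_d d m v"
  shows "(\<Sum>j<m. (inner_d d (v j) x)\<^sup>2) \<le> (norm_d d x)\<^sup>2"
proof -
  define p where "p = (\<lambda>i. \<Sum>j<m. inner_d d (v j) x * v j i)"
  have "inner_d d p p = (\<Sum>j<m. (inner_d d (v j) x)\<^sup>2)"
    using orthonormal_d_sum(2)[OF assms, of "\<lambda>j. inner_d d (v j) x"] by (simp add: norm_d_square p_def)
  moreover have "inner_d d p x = (\<Sum>j<m. (inner_d d (v j) x)\<^sup>2)"
    unfolding p_def by (subst inner_d_sum_left) (simp add: power2_eq_square)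
  moreover have "0 \<le> inner_d d (\<lambda>i. x i - p i) (\<lambda>i. x i - p i)"
    by (rule inner_d_self_nonneg)
  ultimately show ?thesis
    by (simp add: inner_d_diff_left inner_d_diff_right norm_d_square inner_d_comm[of d x p])
qed

text \<open>Gaussian elimination, one equation at a time. The index set is an arbitrary finite set
  so that a pivot variable can be deleted in the induction.\<close>

lemma homogeneous_system_nontrivial_solution:
  fixes a :: "nat \<Rightarrow> 'i \<Rightarrow> real"
  assumes "finite I" "k < card I"
  shows "\<exists>x. (\<exists>i\<in>I. x i \<noteq> 0) \<and> (\<forall>l<k. (\<Sum>i\<in>I. a l i * x i) = 0)"
  using assms
proof (induction k arbitrary: a I)
  case 0
  then have "I \<noteq> {}"
    by auto
  then show ?case
    by (intro exI[of _ "\<lambda>_. 1"]) auto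
next
  case (Suc k)
  show ?case
  proof (cases "\<forall>i\<in>I. a k i = 0")
    case True
    obtain x where x: "\<exists>i\<in>I. x i \<noteq> 0" "\<forall>l<k. (\<Sum>i\<in>I. a l i * x i) = 0"
      using Suc.IH[of I a] Suc.prems by auto
    moreover have "(\<Sum>i\<in>I. a k i * x i) = 0"
      using True by simp
    ultimately show ?thesis
      by (auto simp: less_Suc_eq)
  next
    case False
    then obtain p where p: "p \<in> I" "a k p \<noteq> 0"
      by auto
    define J where "J = I - {p}"
    have J: "finite J" "p \<notin> J" "I = insert p J"
      using Suc.prems p by (auto simp: J_def)
    then have "k < card J"
      using Suc.prems by simp
    \<comment> \<open>The first \<open>k\<close> equations, with variable \<open>p\<close>
      eliminated by means of equation \<open>k\<close>. The value later given to \<open>y p\<close>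
      solves equation \<open>k\<close> itself.\<close>
    then obtain x where x: "\<exists>i\<in>J. x i \<noteq> 0"
        "\<And>l. l < k \<Longrightarrow> (\<Sum>i\<in>J. (a l i - a l p / a k p * a k i) * x i) = 0"
      using Suc.IH[of J "\<lambda>l i. a l i - a l p / a k p * a k i"] J(1) by auto
    define s where "s = (\<Sum>i\<in>J. a k i * x i)"
    define y where "y = x(p := - s / a k p)"
    have eq: "(\<Sum>i\<in>I. a l i * y i) = (\<Sum>i\<in>J. a l i * x i) - a l p / a k p * s" for l
    proof -
      have "(\<Sum>i\<in>J. a l i * y i) = (\<Sum>i\<in>J. a l i * x i)"
        using J(2) by (intro sum.cong) (auto simp: y_def)
      then show ?thesis
        using J by (simp add: y_def)
    qed
    have "(\<Sum>i\<in>I. a l i * y i) = 0" if "l < Suc k" for l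
    proof (cases "l = k")
      case True
      then show ?thesis
        using p by (simp add: eq s_def)
    next
      case False
      then have "(\<Sum>i\<in>J. a l i * x i - a l p / a k p * (a k i * x i)) = 0"
        using x(2)[of l] that by (simp add: algebra_simps)
      then show ?thesis
        unfolding eq s_def by (simp add: sum_subtractf sum_distrib_left)
    qed
    moreover have "\<exists>i\<in>I. y i \<noteq> 0"
      using x(1) J by (auto simp: y_def)
    ultimately show ?thesis
      by blast
  qed
qed

lemma exists_orthogonal_unit_vector:
  assumes "finite S" "card S < d"
  obtains u where "u \<in> Rd d" "inner_d d u u = 1" "\<And>s. s \<in> S \<Longrightarrow> inner_d d s u = 0"
proof -
  obtain a where a: "bij_betw a {..<card S} S"
    using ex_bij_betw_nat_finite[OF assms(1)] by (auto simp: atLeast0LessThan)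
  obtain x i0 where x: "i0 < d" "x i0 \<noteq> (0::real)" "\<And>l. l < card S \<Longrightarrow> (\<Sum>i<d. a l i * x i) = 0"
    using homogeneous_system_nontrivial_solution[of "{..<d}" "card S" a] assms(2) by auto
  \<comment> \<open>Cutting off at \<open>d\<close> puts the solution into the carrier and leaves
    its inner products unchanged.\<close>
  define y where "y i = (if i < d then x i else 0)" for i
  have y: "y \<in> Rd d"
    by (auto simp: y_def topspace_Euclidean_space)
  have ne: "norm_d d y \<noteq> 0"
    using norm_d_eq_0_iff[OF y] x(1,2) by (auto simp: y_def fun_eq_iff)
  have orth: "inner_d d s y = 0" if s: "s \<in> S" for s
  proof -
    have "s \<in> a ` {..<card S}"
      using a s by (simp add: bij_betw_def)
    then show ?thesis
      using x(3) by (auto simp: inner_d_def y_def)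
  qed
  show ?thesis
  proof (rule that[of "\<lambda>i. inverse (norm_d d y) * y i"])
    show "(\<lambda>i. inverse (norm_d d y) * y i) \<in> Rd d"
      using y by (rule Rd_closed)
    show "inner_d d (\<lambda>i. inverse (norm_d d y) * y i) (\<lambda>i. inverse (norm_d d y) * y i) = 1"
      using ne unfolding inner_d_scale_left inner_d_scale_right norm_d_square[symmetric]
      by (simp add: power2_eq_square field_simps)
  qed (simp add: inner_d_scale_right orth)
qed

text \<open>Each new unit vector is taken orthogonal to \<open>S\<close> and to the vectors found so
  far; the dimension count leaves room for \<open>n\<close> of them.\<close>

lemma exists_orthonormal_in_complement:
  assumes "finite S" "card S + n \<le> d"
  shows "\<exists>e. orthonormal_d d n e \<and> (\<forall>i<n. \<forall>s\<in>S. inner_d d s (e i) = 0)"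
  using assms(2)
proof (induction n)
  case 0
  then show ?case
    by (simp add: orthonormal_d_def)
next
  case (Suc n)
  then obtain e where e: "orthonormal_d d n e" "\<And>i s. i < n \<Longrightarrow> s \<in> S \<Longrightarrow> inner_d d s (e i) = 0"
    by auto
  have "card (e ` {..<n}) \<le> n"
    using card_image_le[of "{..<n}" e] by simp
  then have "card (S \<union> e ` {..<n}) < d"
    using card_Un_le[of S "e ` {..<n}"] Suc.prems by linarith
  then obtain u where u: "u \<in> Rd d" "inner_d d u u = 1"
      "\<And>s. s \<in> S \<union> e ` {..<n} \<Longrightarrow> inner_d d s u = 0"
    using exists_orthogonal_unit_vector[of "S \<union> e ` {..<n}" d] assms(1) by blast
  have "inner_d d (e j) u = 0" "inner_d d u (e j) = 0" if "j < n" for j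
    using u(3)[of "e j"] that by (auto simp: inner_d_comm[of d u "e j"])
  then have "orthonormal_d d (Suc n) (e(n := u))"
    using e(1) u(1,2) by (auto simp: orthonormal_d_def less_Suc_eq)
  moreover have "\<forall>i<Suc n. \<forall>s\<in>S. inner_d d s ((e(n := u)) i) = 0"
    using e(2) u(3) by (auto simp: less_Suc_eq)
  ultimately show ?case
    by blast
qed

section \<open>Random signs\<close>

text \<open>A sub-Gaussian bound for a random sign. For small \<open>x\<close> the linear terms of
  \<open>exp y \<le> 1 + y + y^2\<close> at \<open>x\<close> and \<open>- x\<close> cancel; for
  large \<open>x\<close> already \<open>|x| \<le> x^2\<close>.\<close>

lemma exp_symmetric_le: "(exp x + exp (- x)) / 2 \<le> exp (x\<^sup>2)" for x :: real
proof (cases "\<bar>x\<bar> \<le> 1")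
  case True
  have e: "exp y \<le> 1 + y + y\<^sup>2" if "\<bar>y\<bar> \<le> 1" for y :: real
  proof (cases "0 \<le> y")
    case False
    then have "exp y * (1 - y) \<le> 1"
      using exp_ge_add_one_self[of "- y"] by (simp add: exp_minus field_simps)
    moreover have "1 \<le> (1 + y + y\<^sup>2) * (1 - y)"
    proof -
      have "(1 + y + y\<^sup>2) * (1 - y) = 1 - y * y\<^sup>2"
        by (simp add: algebra_simps power2_eq_square)
      then show ?thesis
        using False by (simp add: mult_nonpos_nonneg)
    qed
    ultimately show ?thesis
      using False by (smt (verit) mult_right_le_imp_le)
  qed (use exp_bound that in auto)
  have "exp (- x) \<le> 1 - x + x\<^sup>2"
    using e[of "- x"] True by simp
  then have "exp x + exp (- x) \<le> 2 * (1 + x\<^sup>2)"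
    using e[OF True] by argo
  also have "\<dots> \<le> 2 * exp (x\<^sup>2)"
    by (rule mult_left_mono) (rule exp_ge_add_one_self, simp)
  finally show ?thesis
    by simp
next
  case False
  have "\<bar>x\<bar> * 1 \<le> \<bar>x\<bar> * \<bar>x\<bar>"
    using False by (intro mult_left_mono) auto
  then have "exp \<bar>x\<bar> \<le> exp (x\<^sup>2)"
    by (simp add: power2_eq_square)
  moreover have "exp x \<le> exp \<bar>x\<bar>" "exp (- x) \<le> exp \<bar>x\<bar>"
    by auto
  ultimately show ?thesis
    by argo
qed

text \<open>Derandomized by conditional expectations: some choice of the next sign does not increase
  the exponential moment.\<close>

lemma exists_signs_exp_moment:
  fixes a :: "'x \<Rightarrow> nat \<Rightarrow> real"
  shows "\<exists>s. (\<forall>i. (s i)\<^sup>2 = 1) \<and>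
    (\<Sum>x\<in>P. exp (r * (\<Sum>i<n. s i * a x i) - r\<^sup>2 * (\<Sum>i<n. (a x i)\<^sup>2))) \<le> real (card P)"
proof (induction n)
  case 0
  show ?case
    by (intro exI[of _ "\<lambda>_. 1"]) simp
next
  case (Suc n)
  then obtain s where s: "\<forall>i. (s i)\<^sup>2 = 1"
    "(\<Sum>x\<in>P. exp (r * (\<Sum>i<n. s i * a x i) - r\<^sup>2 * (\<Sum>i<n. (a x i)\<^sup>2))) \<le> real (card P)"
    by blast
  define E where "E \<sigma> x = exp (r * (\<Sum>i<n. s i * a x i) - r\<^sup>2 * (\<Sum>i<n. (a x i)\<^sup>2))
    * (exp (\<sigma> * (r * a x n)) / exp ((r * a x n)\<^sup>2))" for \<sigma> x
  have upd: "exp (r * (\<Sum>i<Suc n. (s(n := \<sigma>)) i * a x i) - r\<^sup>2 * (\<Sum>i<Suc n. (a x i)\<^sup>2)) = E \<sigma> x"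
    for \<sigma> x
    by (simp add: E_def flip: exp_add exp_diff) (simp add: algebra_simps power_mult_distrib)
  \<comment> \<open>\<open>E \<sigma> x\<close> is the summand once sign \<open>n\<close> is fixed
    to \<sigma>. The average over both signs is at most the old summand, so one of the two signs
    keeps the total below \<open>card P\<close>.\<close>
  have "(E 1 x + E (- 1) x) / 2 \<le> exp (r * (\<Sum>i<n. s i * a x i) - r\<^sup>2 * (\<Sum>i<n. (a x i)\<^sup>2))" for x
  proof -
    have "(E 1 x + E (- 1) x) / 2 = exp (r * (\<Sum>i<n. s i * a x i) - r\<^sup>2 * (\<Sum>i<n. (a x i)\<^sup>2))
      * ((exp (r * a x n) + exp (- (r * a x n))) / 2 / exp ((r * a x n)\<^sup>2))"
      by (simp add: E_def field_simps)
    also have "\<dots> \<le> exp (r * (\<Sum>i<n. s i * a x i) - r\<^sup>2 * (\<Sum>i<n. (a x i)\<^sup>2)) * 1"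
      using exp_symmetric_le[of "r * a x n"] by (intro mult_left_mono) (simp_all add: field_simps)
    finally show ?thesis
      by simp
  qed
  then have "(\<Sum>x\<in>P. (E 1 x + E (- 1) x) / 2) \<le> real (card P)"
    by (intro order_trans[OF sum_mono s(2)])
  moreover have "(\<Sum>x\<in>P. (E 1 x + E (- 1) x) / 2) = (sum (E 1) P + sum (E (- 1)) P) / 2"
    by (simp only: sum_divide_distrib[symmetric] sum.distrib)
  ultimately have "sum (E 1) P \<le> real (card P) \<or> sum (E (- 1)) P \<le> real (card P)"
    by argo
  then obtain \<sigma> where \<sigma>: "\<sigma>\<^sup>2 = (1::real)" "(\<Sum>x\<in>P. E \<sigma> x) \<le> real (card P)"
    using that[of 1] that[of "- 1"] by auto
  show ?case
  proof (intro exI[of _ "s(n := \<sigma>)"] conjI)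
    show "\<forall>i. ((s(n := \<sigma>)) i)\<^sup>2 = 1"
      using \<sigma>(1) s(1) by simp
  qed (simp only: upd \<sigma>(2))
qed

text \<open>The vector is a normalized signed sum of an orthonormal family in the complement of
  \<open>S\<close>. No single term of the exponential moment exceeds the total, which handles all of
  \<open>P\<close> at once. The bound is one-sided because only a large positive product could
  activate a piece.\<close>

lemma exists_unit_vector_small_products:
  assumes "finite S" "card S + n \<le> d" "0 < n"
    and "finite P" "\<And>x. x \<in> P \<Longrightarrow> norm_d d x \<le> R" "0 < R"
    and "real (card P) \<le> exp \<Lambda>" "0 < \<Lambda>"
  obtains u where "u \<in> Rd d" "inner_d d u u = 1" "\<And>s. s \<in> S \<Longrightarrow> inner_d d s u = 0"
    "\<And>x. x \<in> P \<Longrightarrow> inner_d d u x \<le> 2 * R * sqrt (\<Lambda> / n)"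
proof -
  obtain e where e: "orthonormal_d d n e" "\<And>i s. i < n \<Longrightarrow> s \<in> S \<Longrightarrow> inner_d d s (e i) = 0"
    using exists_orthonormal_in_complement[OF assms(1,2)] by blast
  \<comment> \<open>By Bessel the variance term \<open>r^2 * B\<close> is then at most \<Lambda>,
    the same size as the logarithm of \<open>card P\<close>; together they give
    \<open>r * Z \<le> 2 * \<Lambda>\<close>.\<close>
  define r where "r = sqrt \<Lambda> / R"
  have r: "0 < r" "r\<^sup>2 * R\<^sup>2 = \<Lambda>"
    using assms by (simp_all add: r_def field_simps)
  obtain s :: "nat \<Rightarrow> real" where s: "\<And>i. (s i)\<^sup>2 = 1"
    "(\<Sum>x\<in>P. exp (r * (\<Sum>i<n. s i * inner_d d (e i) x) - r\<^sup>2 * (\<Sum>i<n. (inner_d d (e i) x)\<^sup>2)))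
      \<le> real (card P)"
    using exists_signs_exp_moment[where P = P and r = r and a = "\<lambda>x i. inner_d d (e i) x" and n = n] by blast
  define u where "u = (\<lambda>i. \<Sum>j<n. (s j / sqrt n) * e j i)"
  show ?thesis
  proof
    show "u \<in> Rd d"
      unfolding u_def using e(1) by (intro Rd_closed) (simp add: orthonormal_d_def)
    show "inner_d d u u = 1"
      using orthonormal_d_sum(2)[OF e(1), of "\<lambda>j. s j / sqrt n"] s(1) assms(3)
      by (simp add: u_def norm_d_square power_divide)
    show "inner_d d t u = 0" if "t \<in> S" for t
      unfolding u_def by (subst inner_d_sum_right) (simp add: e(2) that)
    show "inner_d d u x \<le> 2 * R * sqrt (\<Lambda> / n)" if x: "x \<in> P" for x
    proof -
      define Z where "Z = (\<Sum>i<n. s i * inner_d d (e i) x)"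
      define B where "B = (\<Sum>i<n. (inner_d d (e i) x)\<^sup>2)"
      have "exp (r * Z - r\<^sup>2 * B) \<le> real (card P)"
        using s(2) member_le_sum[OF x, of
          "\<lambda>x. exp (r * (\<Sum>i<n. s i * inner_d d (e i) x) - r\<^sup>2 * (\<Sum>i<n. (inner_d d (e i) x)\<^sup>2))"]
          assms(4) by (simp add: Z_def B_def)
      then have "r * Z - r\<^sup>2 * B \<le> \<Lambda>"
        using assms(7) by (metis exp_le_cancel_iff order_trans)
      moreover have "r\<^sup>2 * B \<le> \<Lambda>"
      proof -
        have "B \<le> R\<^sup>2"
          using bessel_d[OF e(1), of x] assms(5)[OF x] unfolding B_def
          by (smt (verit) norm_d_nonneg power_mono)
        then show ?thesis
          unfolding r(2)[symmetric] by (rule mult_left_mono) simp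
      qed
      ultimately have "r * Z \<le> 2 * \<Lambda>"
        by simp
      then have "Z \<le> 2 * \<Lambda> / r"
        using r(1) by (simp add: field_simps)
      also have "\<dots> = 2 * R * sqrt \<Lambda>"
        using assms(6,8) by (simp add: r_def field_simps)
      finally have "Z / sqrt n \<le> 2 * R * sqrt \<Lambda> / sqrt n"
        using assms(3) by (intro divide_right_mono) simp_all
      moreover have "inner_d d u x = Z / sqrt n"
        unfolding u_def Z_def by (subst inner_d_sum_left) (simp add: sum_divide_distrib)
      ultimately show ?thesis
        by (simp add: real_sqrt_divide)
    qed
  qed
qed

section \<open>The smoothed maximum\<close>

text \<open>The Moreau smoothing \<open>max\<^sub>p (\<langle>p, w\<rangle> - \<eta>/2 \<bar>p\<bar>\<^sup>2)\<close> of the maximum, \<open>p\<close> ranging over the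
  probability simplex. Its maximizer is \<open>p = (w - \<nu>)\<^sub>+ / \<eta>\<close>, where the threshold \<open>\<nu>\<close> makes the
  weights sum to one.\<close>

definition threshold :: "nat \<Rightarrow> real \<Rightarrow> (nat \<Rightarrow> real) \<Rightarrow> real"
  where "threshold m \<eta> w = (THE \<nu>. (\<Sum>j<m. max 0 (w j - \<nu>)) = \<eta>)"

definition weight :: "nat \<Rightarrow> real \<Rightarrow> (nat \<Rightarrow> real) \<Rightarrow> nat \<Rightarrow> real"
  where "weight m \<eta> w j = max 0 (w j - threshold m \<eta> w) / \<eta>"

definition smax :: "nat \<Rightarrow> real \<Rightarrow> (nat \<Rightarrow> real) \<Rightarrow> real"
  where "smax m \<eta> w = (\<Sum>j<m. weight m \<eta> w j * w j) - \<eta> / 2 * (\<Sum>j<m. (weight m \<eta> w j)\<^sup>2)"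

context
  fixes m :: nat and \<eta> :: real
  assumes m: "0 < m" and \<eta>: "0 < \<eta>"
begin

text \<open>The sum strictly decreases in the threshold as long as it is positive, and \<eta> is
  positive.\<close>

lemma threshold_unique:
  assumes "(\<Sum>j<m. max 0 (w j - a)) = \<eta>" "(\<Sum>j<m. max 0 (w j - b)) = \<eta>"
  shows "a = b"
proof -
  have False if "a < b" "(\<Sum>j<m. max 0 (w j - a)) = \<eta>" "(\<Sum>j<m. max 0 (w j - b)) = \<eta>" for a b
  proof -
    have "\<exists>j<m. 0 < w j - b"
    proof (rule ccontr)
      assume "\<not> ?thesis"
      then have "(\<Sum>j<m. max 0 (w j - b)) = 0"
        by (intro sum.neutral) auto
      then show False
        using that(3) \<eta> by simp
    qed
    then have "(\<Sum>j<m. max 0 (w j - b)) < (\<Sum>j<m. max 0 (w j - a))"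
      using that(1) by (intro sum_strict_mono_ex1) force+
    then show False
      using that by simp
  qed
  then show ?thesis
    using assms by (metis linorder_neqE_linordered_idom)
qed

text \<open>Intermediate value theorem: at \<open>w 0 - \<eta>\<close> the entry \<open>0\<close>
  alone contributes \<eta>, while at the upper bound \<open>b\<close> every term vanishes.\<close>

lemma threshold_sum: "(\<Sum>j<m. max 0 (w j - threshold m \<eta> w)) = \<eta>"
proof -
  define b where "b = (\<Sum>j<m. \<bar>w j\<bar>)"
  have b: "w j \<le> b" if "j < m" for j
    using member_le_sum[of j "{..<m}" "\<lambda>j. \<bar>w j\<bar>"] that by (simp add: b_def)
  have "(\<Sum>j<m. max 0 (w j - b)) = 0"
    using b by (intro sum.neutral) auto
  moreover have "\<eta> \<le> (\<Sum>j<m. max 0 (w j - (w 0 - \<eta>)))"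
    using member_le_sum[of 0 "{..<m}" "\<lambda>j. max 0 (w j - (w 0 - \<eta>))"] m \<eta> by simp
  moreover have "w 0 - \<eta> \<le> b"
    using b[of 0] m \<eta> by simp
  ultimately have "\<exists>\<nu>\<ge>w 0 - \<eta>. \<nu> \<le> b \<and> (\<Sum>j<m. max 0 (w j - \<nu>)) = \<eta>"
    using \<eta> by (intro IVT2') (auto intro!: continuous_intros)
  then obtain \<nu> where \<nu>: "(\<Sum>j<m. max 0 (w j - \<nu>)) = \<eta>"
    by blast
  then show ?thesis
    unfolding threshold_def by (rule theI) (rule threshold_unique[OF _ \<nu>])
qed

lemma threshold_eqI: "(\<Sum>j<m. max 0 (w j - \<nu>)) = \<eta> \<Longrightarrow> threshold m \<eta> w = \<nu>"
  by (rule threshold_unique[OF threshold_sum])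

lemma weight_nonneg: "0 \<le> weight m \<eta> w j"
  using \<eta> by (simp add: weight_def)

lemma weight_sum: "(\<Sum>j<m. weight m \<eta> w j) = 1"
  using threshold_sum[of w] \<eta> by (simp add: weight_def flip: sum_divide_distrib)

text \<open>Since \<open>p\<close> and the weights both sum to one, \<open>w\<close> may be shifted
  by the threshold, and the inequality then holds entry by entry. The extra square expresses strong
  concavity of the maximized expression at its maximizer.\<close>

lemma smax_variational:
  assumes p: "\<And>j. j < m \<Longrightarrow> 0 \<le> p j" "(\<Sum>j<m. p j) = 1"
  shows "(\<Sum>j<m. p j * w j) - \<eta> / 2 * (\<Sum>j<m. (p j)\<^sup>2)
    + \<eta> / 2 * (\<Sum>j<m. (weight m \<eta> w j - p j)\<^sup>2) \<le> smax m \<eta> w"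
proof -
  define \<nu> where "\<nu> = threshold m \<eta> w"
  define q where "q = weight m \<eta> w"
  have q: "(\<Sum>j<m. q j) = 1"
    by (simp add: q_def weight_sum)
  have "p j * (w j - \<nu>) - \<eta> / 2 * (p j)\<^sup>2 + \<eta> / 2 * (q j - p j)\<^sup>2
      \<le> q j * (w j - \<nu>) - \<eta> / 2 * (q j)\<^sup>2" if "j < m" for j
  proof (cases "0 \<le> w j - \<nu>")
    case True
    then have "w j - \<nu> = \<eta> * q j"
      using \<eta> by (simp add: q_def weight_def \<nu>_def)
    then show ?thesis
      by (simp only:) (simp add: power2_eq_square algebra_simps)
  next
    case False
    then have "q j = 0"
      by (simp add: q_def weight_def \<nu>_def)
    moreover have "p j * (w j - \<nu>) \<le> 0"
      using False p(1)[OF that] by (simp add: mult_nonneg_nonpos)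
    ultimately show ?thesis
      by simp
  qed
  then have "(\<Sum>j<m. p j * (w j - \<nu>) - \<eta> / 2 * (p j)\<^sup>2 + \<eta> / 2 * (q j - p j)\<^sup>2)
      \<le> (\<Sum>j<m. q j * (w j - \<nu>) - \<eta> / 2 * (q j)\<^sup>2)"
    by (intro sum_mono) simp
  moreover have "(\<Sum>j<m. p j * (w j - \<nu>)) = (\<Sum>j<m. p j * w j) - \<nu>"
    "(\<Sum>j<m. q j * (w j - \<nu>)) = (\<Sum>j<m. q j * w j) - \<nu>"
    using p(2) q by (simp_all add: algebra_simps sum_subtractf flip: sum_distrib_left)
  ultimately show ?thesis
    unfolding smax_def q_def sum.distrib sum_subtractf sum_distrib_left[symmetric] by linarith
qed

text \<open>The weights at \<open>w\<close> are an admissible competitor at \<open>w'\<close>. The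
  surplus square is what yields both smoothness estimates below.\<close>

lemma smax_swap:
  "smax m \<eta> w + (\<Sum>j<m. weight m \<eta> w j * (w' j - w j))
    + \<eta> / 2 * (\<Sum>j<m. (weight m \<eta> w' j - weight m \<eta> w j)\<^sup>2) \<le> smax m \<eta> w'"
  using smax_variational[of "weight m \<eta> w" w'] weight_nonneg weight_sum
  by (simp add: smax_def[of m \<eta> w] algebra_simps sum_subtractf)

lemma smax_subgradient:
  "smax m \<eta> w + (\<Sum>j<m. weight m \<eta> w j * (w' j - w j)) \<le> smax m \<eta> w'"
proof -
  have "0 \<le> \<eta> / 2 * (\<Sum>j<m. (weight m \<eta> w' j - weight m \<eta> w j)\<^sup>2)"
    using \<eta> by (simp add: sum_nonneg)
  then show ?thesis
    using smax_swap[of w w'] by linarith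
qed

text \<open>Adding \<open>smax_swap\<close> in both directions gives strong monotonicity
  \<open>\<eta> |D|^2 \<le> <D, w - w'>\<close>; the inequality \<open>2ab \<le> a^2 + b^2\<close>
  then does the work of Cauchy-Schwarz.\<close>

lemma weight_lipschitz:
  "(\<Sum>j<m. (weight m \<eta> w j - weight m \<eta> w' j)\<^sup>2) \<le> (\<Sum>j<m. (w j - w' j)\<^sup>2) / \<eta>\<^sup>2"
proof -
  define D where "D j = weight m \<eta> w j - weight m \<eta> w' j" for j
  have "(\<Sum>j<m. (weight m \<eta> w' j - weight m \<eta> w j)\<^sup>2) = (\<Sum>j<m. (D j)\<^sup>2)"
    by (simp add: D_def power2_commute)
  moreover have "(\<Sum>j<m. weight m \<eta> w j * (w' j - w j)) + (\<Sum>j<m. weight m \<eta> w' j * (w j - w' j))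
      = - (\<Sum>j<m. D j * (w j - w' j))"
    by (simp add: D_def algebra_simps flip: sum.distrib sum_negf)
  ultimately have 1: "\<eta> * (\<Sum>j<m. (D j)\<^sup>2) \<le> (\<Sum>j<m. D j * (w j - w' j))"
    using smax_swap[of w w'] smax_swap[of w' w] by (simp add: D_def)
  have "2 * \<eta> * (D j * (w j - w' j)) \<le> \<eta>\<^sup>2 * (D j)\<^sup>2 + (w j - w' j)\<^sup>2" for j
    using sum_squares_ge_zero[of "\<eta> * D j - (w j - w' j)" 0] by (simp add: power2_eq_square algebra_simps)
  then have "(\<Sum>j<m. 2 * \<eta> * (D j * (w j - w' j))) \<le> (\<Sum>j<m. \<eta>\<^sup>2 * (D j)\<^sup>2 + (w j - w' j)\<^sup>2)"
    by (intro sum_mono)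
  then have "2 * \<eta> * (\<Sum>j<m. D j * (w j - w' j)) \<le> \<eta>\<^sup>2 * (\<Sum>j<m. (D j)\<^sup>2) + (\<Sum>j<m. (w j - w' j)\<^sup>2)"
    by (simp add: sum.distrib sum_distrib_left)
  moreover have "2 * \<eta> * (\<eta> * (\<Sum>j<m. (D j)\<^sup>2)) \<le> 2 * \<eta> * (\<Sum>j<m. D j * (w j - w' j))"
    using 1 \<eta> by (intro mult_left_mono) simp_all
  ultimately have "\<eta>\<^sup>2 * (\<Sum>j<m. (D j)\<^sup>2) \<le> (\<Sum>j<m. (w j - w' j)\<^sup>2)"
    by (simp add: power2_eq_square algebra_simps)
  then show ?thesis
    using \<eta> by (simp add: D_def field_simps)
qed

text \<open>Apply \<open>smax_swap\<close> from \<open>w'\<close> to \<open>w\<close> and absorb the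
  cross term between weight change and \<open>w' - w\<close> into the surplus square.\<close>

lemma smax_upper:
  "smax m \<eta> w' \<le> smax m \<eta> w + (\<Sum>j<m. weight m \<eta> w j * (w' j - w j)) + (\<Sum>j<m. (w' j - w j)\<^sup>2) / (2 * \<eta>)"
proof -
  define D where "D j = weight m \<eta> w' j - weight m \<eta> w j" for j
  have "D j * (w' j - w j) \<le> \<eta> / 2 * (D j)\<^sup>2 + (w' j - w j)\<^sup>2 / (2 * \<eta>)" for j
    using sum_squares_ge_zero[of "\<eta> * D j - (w' j - w j)" 0] \<eta> by (simp add: power2_eq_square field_simps)
  then have "(\<Sum>j<m. D j * (w' j - w j)) \<le> (\<Sum>j<m. \<eta> / 2 * (D j)\<^sup>2 + (w' j - w j)\<^sup>2 / (2 * \<eta>))"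
    by (intro sum_mono)
  also have "\<dots> = \<eta> / 2 * (\<Sum>j<m. (D j)\<^sup>2) + (\<Sum>j<m. (w' j - w j)\<^sup>2) / (2 * \<eta>)"
    by (simp add: sum.distrib sum_distrib_left sum_divide_distrib)
  finally have 1: "(\<Sum>j<m. D j * (w' j - w j)) \<le> \<dots>" .
  have 2: "(\<Sum>j<m. (weight m \<eta> w j - weight m \<eta> w' j)\<^sup>2) = (\<Sum>j<m. (D j)\<^sup>2)"
    by (simp add: D_def power2_commute)
  have 3: "(\<Sum>j<m. weight m \<eta> w' j * (w j - w' j))
      = - (\<Sum>j<m. D j * (w' j - w j)) - (\<Sum>j<m. weight m \<eta> w j * (w' j - w j))"
    by (simp add: D_def algebra_simps flip: sum_subtractf sum_negf)
  show ?thesis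
    using smax_swap[of w' w] 1 unfolding 2 3 by simp
qed

lemma smax_ge: "k < m \<Longrightarrow> w k - \<eta> / 2 \<le> smax m \<eta> w"
proof -
  assume k: "k < m"
  define p :: "nat \<Rightarrow> real" where "p j = (if j = k then 1 else 0)" for j
  have "p j * w j = (if j = k then w j else 0)" "(p j)\<^sup>2 = p j" for j
    by (simp_all add: p_def)
  moreover have "(\<Sum>j<m. p j) = 1"
    using k by (simp add: p_def)
  ultimately have "(\<Sum>j<m. p j) = 1" "(\<Sum>j<m. p j * w j) = w k" "(\<Sum>j<m. (p j)\<^sup>2) = 1"
    using k by simp_all
  moreover have "0 \<le> \<eta> / 2 * (\<Sum>j<m. (weight m \<eta> w j - p j)\<^sup>2)"
    using \<eta> by (simp add: sum_nonneg)
  moreover have "0 \<le> p j" for j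
    by (simp add: p_def)
  ultimately show ?thesis
    using smax_variational[of p w] by simp
qed

lemma smax_le:
  assumes "\<And>j. j < m \<Longrightarrow> w j \<le> M"
  shows "smax m \<eta> w \<le> M"
proof -
  have "(\<Sum>j<m. weight m \<eta> w j * w j) \<le> (\<Sum>j<m. weight m \<eta> w j * M)"
    using assms weight_nonneg by (intro sum_mono mult_left_mono) auto
  also have "\<dots> = M"
    using weight_sum[of w] by (simp flip: sum_distrib_right)
  moreover have "0 \<le> \<eta> / 2 * (\<Sum>j<m. (weight m \<eta> w j)\<^sup>2)"
    using \<eta> by (simp add: sum_nonneg)
  ultimately show ?thesis
    unfolding smax_def by linarith
qed

text \<open>Entries that lie \<open>\<eta>\<close> below some other entry carry no weight.\<close>

lemma smax_cong:
  assumes "k < m" "w' k = w k"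
    and eq: "\<And>j. j < m \<Longrightarrow> w' j = w j \<or> w j \<le> w k - \<eta> \<and> w' j \<le> w k - \<eta>"
  shows "smax m \<eta> w' = smax m \<eta> w"
proof -
  define \<nu> where "\<nu> = threshold m \<eta> w"
  have sum: "(\<Sum>j<m. max 0 (w j - \<nu>)) = \<eta>"
    unfolding \<nu>_def by (rule threshold_sum)
  \<comment> \<open>No single term exceeds the total \<eta>, so the threshold is at least
    \<open>w k - \<eta>\<close>; every altered entry stays below it.\<close>
  have "max 0 (w k - \<nu>) \<le> \<eta>"
    using member_le_sum[of k "{..<m}" "\<lambda>j. max 0 (w j - \<nu>)"] assms(1) sum by simp
  then have *: "w' j = w j \<or> w j \<le> \<nu> \<and> w' j \<le> \<nu>" if "j < m" for j
    using eq[OF that] by auto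
  then have "max 0 (w' j - \<nu>) = max 0 (w j - \<nu>)" if "j < m" for j
    using that by fastforce
  then have "threshold m \<eta> w' = \<nu>"
    using sum by (intro threshold_eqI) simp
  then have wt: "weight m \<eta> w' j = weight m \<eta> w j" "weight m \<eta> w' j * w' j = weight m \<eta> w j * w j"
    if "j < m" for j
    using *[OF that] by (auto simp: weight_def \<nu>_def)
  have "(\<Sum>j<m. weight m \<eta> w' j * w' j) = (\<Sum>j<m. weight m \<eta> w j * w j)"
    by (rule sum.cong[OF refl]) (use wt(2) in blast)
  then show ?thesis
    by (simp add: smax_def wt(1))
qed

end

section \<open>Gradients on the coordinate space\<close>

lemma norm_d_expand:
  "(norm_d d y)\<^sup>2 = (norm_d d x)\<^sup>2 + 2 * inner_d d x (\<lambda>i. y i - x i) + (norm_d d (\<lambda>i. y i - x i))\<^sup>2"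
  by (simp add: norm_d_square inner_d_diff_left inner_d_diff_right inner_d_comm[of d y x])

lemma component_le_norm_d: "i < d \<Longrightarrow> \<bar>x i\<bar> \<le> norm_d d x"
  using member_le_L2_set[of "{..<d}" i "\<lambda>i. \<bar>x i\<bar>"] by (simp add: norm_d_def L2_set_def)

lemma norm_d_pos: "norm_d d x \<noteq> 0 \<Longrightarrow> 0 < norm_d d x"
  by (metis norm_d_nonneg order_le_less)

lemma eventually_atin_Rd: "\<forall>\<^sub>F y in atin (Euclidean_space d) x. y \<in> Rd d"
  unfolding eventually_atin by (auto intro!: exI[of _ "Rd d"])

lemma tendsto_norm_d_diff:
  assumes "x \<in> Rd d"
  shows "((\<lambda>y. norm_d d (\<lambda>i. y i - x i)) \<longlongrightarrow> 0) (atin (Euclidean_space d) x)"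
proof -
  have "continuous_map (Euclidean_space d) euclideanreal (\<lambda>y. y i)" for i
    unfolding Euclidean_space_def
    by (intro continuous_map_from_subtopology continuous_map_product_projection) simp
  then have "((\<lambda>y. y i) \<longlongrightarrow> x i) (atin (Euclidean_space d) x)" for i
    using assms unfolding continuous_map_atin limitin_canonical_iff by blast
  then have "((\<lambda>y. sqrt (\<Sum>i<d. (y i - x i)\<^sup>2)) \<longlongrightarrow> sqrt (\<Sum>i<d. (x i - x i)\<^sup>2)) (atin (Euclidean_space d) x)"
    by (intro tendsto_intros)
  then show ?thesis
    by (simp add: norm_d_def L2_set_def)
qed

lemma has_gradientI:
  assumes "x \<in> Rd d" "g \<in> Rd d"
    and bound: "\<And>y. \<bar>f y - f x - inner_d d g (\<lambda>i. y i - x i)\<bar> \<le> C * (norm_d d (\<lambda>i. y i - x i))\<^sup>2"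
  shows "has_gradient d f g x"
  unfolding has_gradient_def
proof (rule conjI[OF assms(2)], rule Lim_null_comparison)
  show "\<forall>\<^sub>F y in atin (Euclidean_space d) x.
      norm ((f y - f x - inner_d d g (\<lambda>i. y i - x i)) / norm_d d (\<lambda>i. y i - x i))
      \<le> C * norm_d d (\<lambda>i. y i - x i)"
  proof (rule always_eventually, rule allI)
    fix y
    show "norm ((f y - f x - inner_d d g (\<lambda>i. y i - x i)) / norm_d d (\<lambda>i. y i - x i))
      \<le> C * norm_d d (\<lambda>i. y i - x i)"
    \<comment> \<open>If the norm is zero the quotient is \<open>0\<close> by the convention on
      division by zero.\<close>
    proof (cases "norm_d d (\<lambda>i. y i - x i) = 0")
      case False
      then have "0 < norm_d d (\<lambda>i. y i - x i)"
        by (rule norm_d_pos)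
      then show ?thesis
        using bound[of y] by (simp add: pos_divide_le_eq power2_eq_square mult.assoc)
    qed simp
  qed
  show "((\<lambda>y. C * norm_d d (\<lambda>i. y i - x i)) \<longlongrightarrow> 0) (atin (Euclidean_space d) x)"
    using tendsto_mult_right_zero[OF tendsto_norm_d_diff[OF assms(1)]] .
qed

text \<open>A ray from \<open>x\<close> avoids \<open>x\<close> for nonzero \<open>t\<close>, as the
  punctured filter \<open>atin\<close> requires. This turns limits on the space into limits in one
  real variable.\<close>

lemma filterlim_line_atin:
  assumes "x \<in> Rd d" "u \<in> Rd d" "u \<noteq> (\<lambda>_. 0)"
  shows "filterlim (\<lambda>t i. x i + t * u i) (atin (Euclidean_space d) x) (at_right 0)"
proof -
  have path: "continuous_map euclideanreal (Euclidean_space d) (\<lambda>t i. x i + t * u i)"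
    unfolding Euclidean_space_def continuous_map_in_subtopology continuous_map_componentwise_UNIV
  proof (intro conjI allI)
    show "continuous_map euclideanreal euclideanreal (\<lambda>t. x k + t * u k)" for k
      by (simp add: continuous_intros)
    show "(\<lambda>t i. x i + t * u i) \<in> topspace euclideanreal \<rightarrow> {x. \<forall>i\<ge>d. x i = 0}"
      using assms by (auto simp: topspace_Euclidean_space)
  qed
  obtain k where k: "u k \<noteq> 0"
    using assms(3) by auto
  show ?thesis
    unfolding filterlim_iff
  proof (intro allI impI)
    fix P assume "eventually P (atin (Euclidean_space d) x)"
    then obtain U where U: "openin (Euclidean_space d) U" "x \<in> U" "\<And>y. y \<in> U - {x} \<Longrightarrow> P y"
      using assms(1) unfolding eventually_atin by blast
    have "open {t. (\<lambda>i. x i + t * u i) \<in> U}"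
      using openin_continuous_map_preimage[OF path U(1)] by simp
    then have "eventually (\<lambda>t. t \<in> {t. (\<lambda>i. x i + t * u i) \<in> U}) (nhds 0)"
      using U(2) by (intro eventually_nhds_in_open) auto
    then show "eventually (\<lambda>t. P (\<lambda>i. x i + t * u i)) (at_right 0)"
      unfolding eventually_at_filter
    proof eventually_elim
      case (elim t)
      have "(\<lambda>i. x i + t * u i) \<noteq> x" if "t \<noteq> 0"
        using k that by (auto simp: fun_eq_iff)
      then show ?case
        using elim U(3) by auto
    qed
  qed
qed

text \<open>Along the ray in direction \<open>u = g - h\<close> the two difference quotients differ
  by the constant \<open>norm_d d u\<close>, yet both tend to \<open>0\<close>.\<close>

lemma has_gradient_unique:
  assumes "has_gradient d f g x" "has_gradient d f h x" "x \<in> Rd d"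
  shows "g = h"
proof (rule ccontr)
  assume "g \<noteq> h"
  define u where "u = (\<lambda>i. g i - h i)"
  have u: "u \<in> Rd d" "u \<noteq> (\<lambda>_. 0)"
    using assms(1,2) \<open>g \<noteq> h\<close> unfolding has_gradient_def u_def
    by (auto simp: topspace_Euclidean_space fun_eq_iff)
  then have n: "0 < norm_d d u"
    by (simp add: norm_d_pos norm_d_eq_0_iff)
  let ?q = "\<lambda>g y. (f y - f x - inner_d d g (\<lambda>i. y i - x i)) / norm_d d (\<lambda>i. y i - x i)"
  have "((\<lambda>y. ?q h y - ?q g y) \<longlongrightarrow> 0 - 0) (atin (Euclidean_space d) x)"
    using assms by (intro tendsto_diff) (simp_all add: has_gradient_def)
  then have "((\<lambda>t. ?q h (\<lambda>i. x i + t * u i) - ?q g (\<lambda>i. x i + t * u i)) \<longlongrightarrow> 0) (at_right 0)"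
    unfolding diff_0_right by (rule filterlim_compose[OF _ filterlim_line_atin[OF assms(3) u]])
  moreover have "\<forall>\<^sub>F t in at_right 0. ?q h (\<lambda>i. x i + t * u i) - ?q g (\<lambda>i. x i + t * u i) = norm_d d u"
    using eventually_at_right_less[of 0]
  proof eventually_elim
    case (elim t)
    have "inner_d d g u - inner_d d h u = (norm_d d u)\<^sup>2"
      by (simp add: u_def norm_d_square inner_d_diff_left)
    then have "t * inner_d d g u - t * inner_d d h u = t * norm_d d u * norm_d d u"
      unfolding right_diff_distrib[symmetric] by (simp add: power2_eq_square)
    then show ?case
      using elim n by (simp add: inner_d_scale_right norm_d_scale flip: diff_divide_distrib)
  qed
  ultimately have "((\<lambda>t::real. norm_d d u) \<longlongrightarrow> 0) (at_right 0)"
    by (rule Lim_transform_eventually)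
  then show False
    using n by (simp add: tendsto_const_iff)
qed

lemma gradient_eqI: "has_gradient d f g x \<Longrightarrow> x \<in> Rd d \<Longrightarrow> gradient d f x = g"
  unfolding gradient_def by (rule the_equality) (auto intro: has_gradient_unique)

text \<open>The topology is the product topology, so continuity is checked by coordinates, each
  dominated by the Euclidean norm; coordinates from \<open>d\<close> on are constantly
  \<open>0\<close>.\<close>

lemma continuous_map_lipschitz_d:
  assumes maps: "\<And>x. x \<in> Rd d \<Longrightarrow> h x \<in> Rd d"
    and lip: "\<And>x y. x \<in> Rd d \<Longrightarrow> y \<in> Rd d \<Longrightarrow> norm_d d (\<lambda>i. h x i - h y i) \<le> L * norm_d d (\<lambda>i. x i - y i)"
  shows "continuous_map (Euclidean_space d) (Euclidean_space d) h"
proof -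
  have "continuous_map (Euclidean_space d) euclideanreal (\<lambda>x. h x k)" for k
    unfolding continuous_map_atin limitin_canonical_iff
  proof
    fix x assume x: "x \<in> Rd d"
    have "((\<lambda>y. h y k - h x k) \<longlongrightarrow> 0) (atin (Euclidean_space d) x)"
    proof (rule Lim_null_comparison)
      show "\<forall>\<^sub>F y in atin (Euclidean_space d) x. norm (h y k - h x k) \<le> L * norm_d d (\<lambda>i. y i - x i)"
        using eventually_atin_Rd
      proof eventually_elim
        case (elim y)
        have "\<bar>h y k - h x k\<bar> \<le> norm_d d (\<lambda>i. h y i - h x i)"
        proof (cases "k < d")
          case False
          then show ?thesis
            using maps[OF elim] maps[OF x] by (simp add: topspace_Euclidean_space)
        qed (rule component_le_norm_d)
        then show ?case
          using lip[OF elim x] by simp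
      qed
      show "((\<lambda>y. L * norm_d d (\<lambda>i. y i - x i)) \<longlongrightarrow> 0) (atin (Euclidean_space d) x)"
        using tendsto_mult_right_zero[OF tendsto_norm_d_diff[OF x]] .
    qed
    then show "((\<lambda>y. h y k) \<longlongrightarrow> h x k) (atin (Euclidean_space d) x)"
      by (simp add: LIM_zero_iff)
  qed
  then have "continuous_map (Euclidean_space d) (powertop_real UNIV) h"
    by (simp add: continuous_map_componentwise_UNIV)
  then show ?thesis
    using maps unfolding Euclidean_space_def[of d] continuous_map_in_subtopology
    by (auto simp: topspace_Euclidean_space)
qed

text \<open>Take the supporting hyperplane at the intermediate point \<open>z\<close>; in the convex
  combination of its values at \<open>x\<close> and \<open>y\<close> the linear parts
  cancel.\<close>

lemma convex_dI:
  assumes "\<And>x y. f y \<ge> f x + inner_d d (g x) (\<lambda>i. y i - x i)"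
  shows "convex_d d f"
  unfolding convex_d_def
proof (intro ballI)
  fix x y and t :: real
  assume t: "t \<in> {0..1}"
  define z :: "nat \<Rightarrow> real" where "z = (\<lambda>i. (1 - t) * x i + t * y i)"
  have "(1 - t) * (f z + inner_d d (g z) (\<lambda>i. x i - z i)) \<le> (1 - t) * f x"
    "t * (f z + inner_d d (g z) (\<lambda>i. y i - z i)) \<le> t * f y"
    using t assms by (auto intro!: mult_left_mono)
  moreover have "(1 - t) * inner_d d (g z) (\<lambda>i. x i - z i) + t * inner_d d (g z) (\<lambda>i. y i - z i)
      = inner_d d (g z) (\<lambda>i. (1 - t) * (x i - z i) + t * (y i - z i))"
    by (simp only: inner_d_add_right inner_d_scale_right)
  moreover have "(\<lambda>i. (1 - t) * (x i - z i) + t * (y i - z i)) = (\<lambda>_. 0)"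
    by (auto simp: z_def algebra_simps)
  ultimately show "f (\<lambda>i. (1 - t) * x i + t * y i) \<le> (1 - t) * f x + t * f y"
    unfolding z_def[symmetric] by (simp add: algebra_simps)
qed

section \<open>The hard instance\<close>

text \<open>The offsets make an earlier piece with zero product exceed a later one by at least
  \<eta> whenever the later product is at most \<eta>.\<close>

definition score :: "nat \<Rightarrow> real \<Rightarrow> (nat \<Rightarrow> nat \<Rightarrow> real) \<Rightarrow> (nat \<Rightarrow> real) \<Rightarrow> nat \<Rightarrow> real"
  where "score d \<eta> v x j = inner_d d (v j) x - 2 * \<eta> * real j"

text \<open>The smoothed maximum has a \<open>1 / \<eta>\<close>-Lipschitz gradient, so its
  prefactor gives smoothness \<open>\<beta> / 2\<close>; the quadratic, of modulus
  \<open>\<mu> \<le> \<beta> / 2\<close>, fits into the other half.\<close>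

definition hard_fun :: "nat \<Rightarrow> nat \<Rightarrow> real \<Rightarrow> real \<Rightarrow> (nat \<Rightarrow> nat \<Rightarrow> real) \<Rightarrow> (nat \<Rightarrow> real) \<Rightarrow> real"
  where "hard_fun d m \<beta> \<eta> v x =
    \<beta> * \<eta> / 2 * smax m \<eta> (score d \<eta> v x) + \<beta> / (8192 * (real m)\<^sup>2) * (norm_d d x)\<^sup>2"

definition hard_grad :: "nat \<Rightarrow> nat \<Rightarrow> real \<Rightarrow> real \<Rightarrow> (nat \<Rightarrow> nat \<Rightarrow> real) \<Rightarrow> (nat \<Rightarrow> real) \<Rightarrow> nat \<Rightarrow> real"
  where "hard_grad d m \<beta> \<eta> v x =
    (\<lambda>i. (\<Sum>j<m. (\<beta> * \<eta> / 2 * weight m \<eta> (score d \<eta> v x) j) * v j i) + \<beta> / (4096 * (real m)\<^sup>2) * x i)"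

locale hard_instance =
  fixes d m :: nat and \<beta> \<eta> :: real and v :: "nat \<Rightarrow> nat \<Rightarrow> real"
  assumes m: "0 < m" and \<eta>: "0 < \<eta>" and \<beta>: "0 < \<beta>" and orthonormal: "orthonormal_d d m v"
begin

abbreviation "F \<equiv> hard_fun d m \<beta> \<eta> v"
abbreviation "G \<equiv> hard_grad d m \<beta> \<eta> v"
abbreviation "\<mu> \<equiv> \<beta> / (4096 * (real m)\<^sup>2)"

lemma \<mu>_pos: "0 < \<mu>"
  using m \<beta> by simp

lemma \<mu>_le: "\<mu> \<le> \<beta> / 2"
proof -
  have "1 \<le> (real m)\<^sup>2"
    using m by (simp add: one_le_power)
  then have "2 \<le> 4096 * (real m)\<^sup>2"
    by linarith
  then show ?thesis
    using \<beta> m by (intro divide_left_mono) simp_all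
qed

lemma score_diff: "score d \<eta> v y j - score d \<eta> v x j = inner_d d (v j) (\<lambda>i. y i - x i)"
  by (simp add: score_def inner_d_diff_right)

lemma inner_G:
  "inner_d d (G x) z = \<beta> * \<eta> / 2 * (\<Sum>j<m. weight m \<eta> (score d \<eta> v x) j * inner_d d (v j) z) + \<mu> * inner_d d x z"
  unfolding hard_grad_def inner_d_add_left inner_d_sum_left inner_d_scale_left sum_distrib_left
  by (simp add: mult.assoc)

text \<open>The quadratic part contributes its remainder exactly, so both bounds on \<open>F\<close>
  reduce to bounds on the remainder of \<open>smax\<close>.\<close>

lemma F_expand:
  "F y - F x - inner_d d (G x) (\<lambda>i. y i - x i) =
    \<beta> * \<eta> / 2 * (smax m \<eta> (score d \<eta> v y) - smax m \<eta> (score d \<eta> v x)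
      - (\<Sum>j<m. weight m \<eta> (score d \<eta> v x) j * (score d \<eta> v y j - score d \<eta> v x j)))
    + \<mu> / 2 * (norm_d d (\<lambda>i. y i - x i))\<^sup>2"
  unfolding hard_fun_def inner_G score_diff norm_d_expand[of d y x]
  by (simp add: algebra_simps)

lemma F_lower: "F x + inner_d d (G x) (\<lambda>i. y i - x i) + \<mu> / 2 * (norm_d d (\<lambda>i. y i - x i))\<^sup>2 \<le> F y"
proof -
  have "0 \<le> \<beta> * \<eta> / 2 * (smax m \<eta> (score d \<eta> v y) - smax m \<eta> (score d \<eta> v x)
      - (\<Sum>j<m. weight m \<eta> (score d \<eta> v x) j * (score d \<eta> v y j - score d \<eta> v x j)))"
    using smax_subgradient[OF m \<eta>, of "score d \<eta> v x" "score d \<eta> v y"] \<beta> \<eta>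
    by (intro mult_nonneg_nonneg) simp_all
  then show ?thesis
    using F_expand[of y x] by linarith
qed

text \<open>Bessel bounds the score differences by the distance of the points; each part of
  \<open>F\<close> then contributes at most \<open>\<beta> / 4\<close> times its square.\<close>

lemma F_upper: "F y \<le> F x + inner_d d (G x) (\<lambda>i. y i - x i) + \<beta> / 2 * (norm_d d (\<lambda>i. y i - x i))\<^sup>2"
proof -
  define N where "N = (norm_d d (\<lambda>i. y i - x i))\<^sup>2"
  define D where "D = smax m \<eta> (score d \<eta> v y) - smax m \<eta> (score d \<eta> v x)
      - (\<Sum>j<m. weight m \<eta> (score d \<eta> v x) j * (score d \<eta> v y j - score d \<eta> v x j))"
  have "(\<Sum>j<m. (score d \<eta> v y j - score d \<eta> v x j)\<^sup>2) \<le> N"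
    unfolding score_diff N_def by (rule bessel_d[OF orthonormal])
  then have "(\<Sum>j<m. (score d \<eta> v y j - score d \<eta> v x j)\<^sup>2) / (2 * \<eta>) \<le> N / (2 * \<eta>)"
    using \<eta> by (simp add: divide_right_mono)
  then have "D \<le> N / (2 * \<eta>)"
    using smax_upper[OF m \<eta>, of "score d \<eta> v y" "score d \<eta> v x"] by (simp add: D_def)
  then have "\<beta> * \<eta> / 2 * D \<le> \<beta> * \<eta> / 2 * (N / (2 * \<eta>))"
    using \<beta> \<eta> by (intro mult_left_mono) simp_all
  also have "\<dots> = \<beta> / 4 * N"
    using \<eta> by simp
  finally have "\<beta> * \<eta> / 2 * D \<le> \<beta> / 4 * N" .
  moreover have "\<mu> / 2 * N \<le> \<beta> / 4 * N"
    using \<mu>_le by (intro mult_right_mono) (simp_all add: N_def)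
  ultimately show ?thesis
    using F_expand[of y x] by (simp add: D_def N_def)
qed

lemma G_Rd: "x \<in> Rd d \<Longrightarrow> G x \<in> Rd d"
  unfolding hard_grad_def using orthonormal by (intro Rd_closed) (simp_all add: orthonormal_d_def)

lemma has_gradient_F: "x \<in> Rd d \<Longrightarrow> has_gradient d F (G x) x"
proof (rule has_gradientI)
  fix y
  have "0 \<le> \<mu> / 2 * (norm_d d (\<lambda>i. y i - x i))\<^sup>2"
    using \<mu>_pos by (intro mult_nonneg_nonneg) simp_all
  then show "\<bar>F y - F x - inner_d d (G x) (\<lambda>i. y i - x i)\<bar> \<le> \<beta> / 2 * (norm_d d (\<lambda>i. y i - x i))\<^sup>2"
    using F_lower[of x y] F_upper[of y x] by linarith
qed (simp_all add: G_Rd)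

lemma gradient_F: "x \<in> Rd d \<Longrightarrow> gradient d F x = G x"
  by (rule gradient_eqI[OF has_gradient_F])

lemma G_lipschitz: "norm_d d (\<lambda>i. G x i - G y i) \<le> \<beta> * norm_d d (\<lambda>i. x i - y i)"
proof -
  define c where "c j = \<beta> * \<eta> / 2 * (weight m \<eta> (score d \<eta> v x) j - weight m \<eta> (score d \<eta> v y) j)" for j
  define N where "N = norm_d d (\<lambda>i. x i - y i)"
  have eq: "(\<lambda>i. G x i - G y i) = (\<lambda>i. (\<Sum>j<m. c j * v j i) + \<mu> * (x i - y i))"
    unfolding hard_grad_def c_def
    by (auto simp: algebra_simps sum_subtractf diff_divide_distrib)
  have "(norm_d d (\<lambda>i. \<Sum>j<m. c j * v j i))\<^sup>2 = (\<Sum>j<m. (c j)\<^sup>2)"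
    by (rule orthonormal_d_sum(2)[OF orthonormal])
  also have "\<dots> = (\<beta> * \<eta> / 2)\<^sup>2 *
      (\<Sum>j<m. (weight m \<eta> (score d \<eta> v x) j - weight m \<eta> (score d \<eta> v y) j)\<^sup>2)"
    by (simp only: c_def power_mult_distrib sum_distrib_left)
  also have "\<dots> \<le> (\<beta> * \<eta> / 2)\<^sup>2 * ((\<Sum>j<m. (inner_d d (v j) (\<lambda>i. x i - y i))\<^sup>2) / \<eta>\<^sup>2)"
    using weight_lipschitz[OF m \<eta>, of "score d \<eta> v x" "score d \<eta> v y"]
    unfolding score_diff by (rule mult_left_mono) simp
  also have "\<dots> \<le> (\<beta> * \<eta> / 2)\<^sup>2 * (N\<^sup>2 / \<eta>\<^sup>2)"
    unfolding N_def by (intro mult_left_mono divide_right_mono bessel_d[OF orthonormal]) simp_all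
  also have "\<dots> = (\<beta> / 2 * N)\<^sup>2"
    using \<eta> by (simp add: power_mult_distrib power_divide)
  finally have "norm_d d (\<lambda>i. \<Sum>j<m. c j * v j i) \<le> \<beta> / 2 * N"
    by (rule power2_le_imp_le) (use \<beta> in \<open>simp add: N_def\<close>)
  moreover have "norm_d d (\<lambda>i. \<mu> * (x i - y i)) \<le> \<beta> / 2 * N"
    unfolding norm_d_scale N_def[symmetric] using \<mu>_pos \<mu>_le
    by (intro mult_right_mono) (simp_all add: N_def)
  ultimately show ?thesis
    unfolding eq N_def[symmetric]
    using norm_d_add[of d "\<lambda>i. \<Sum>j<m. c j * v j i" "\<lambda>i. \<mu> * (x i - y i)"] by linarith
qed

text \<open>At the minimizer \<open>-(A/\<mu>) \<Sum>\<^sub>j l\<^sub>j v\<^sub>j\<close>, with \<open>A = \<beta> \<eta> / 2\<close>, every piece is active; stationarity says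
  that the smoothed maximum has weights \<open>l\<close>, which is the linear system solved by \<open>optimal_weight\<close>.\<close>

definition optimal_weight :: "nat \<Rightarrow> real"
  where "optimal_weight j = 1 / real m + (real m - 1 - 2 * real j) / (1 + 2048 * (real m)\<^sup>2)"

definition minimizer :: "nat \<Rightarrow> real"
  where "minimizer = (\<lambda>i. \<Sum>j<m. (- (2048 * (real m)\<^sup>2 * \<eta>) * optimal_weight j) * v j i)"

lemma minimizer_Rd: "minimizer \<in> Rd d"
  unfolding minimizer_def using orthonormal by (intro Rd_closed) (simp add: orthonormal_d_def)

text \<open>The correction to \<open>1 / m\<close> is at most \<open>1 / (2048 m)\<close> in
  absolute value. The lower bound makes these numbers admissible weights, the upper one controls the
  norm of the minimizer.\<close>

lemma optimal_weight_bounds: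
  assumes "j < m"
  shows "0 \<le> optimal_weight j" "optimal_weight j \<le> (1 + 1 / 2048) / real m"
proof -
  have "\<bar>(real m - 1 - 2 * real j) / (1 + 2048 * (real m)\<^sup>2)\<bar> \<le> real m / (2048 * (real m)\<^sup>2)"
    unfolding abs_divide using assms m by (intro frac_le) auto
  also have "\<dots> = 1 / 2048 / real m"
    using m by (simp add: power2_eq_square)
  finally have *: "\<bar>(real m - 1 - 2 * real j) / (1 + 2048 * (real m)\<^sup>2)\<bar> \<le> 1 / 2048 / real m" .
  have "1 / 2048 / real m \<le> 1 / real m"
    using m by (intro divide_right_mono) simp_all
  then show "0 \<le> optimal_weight j" "optimal_weight j \<le> (1 + 1 / 2048) / real m"
    using * unfolding abs_le_iff optimal_weight_def add_divide_distrib by linarith+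
qed

lemma optimal_weight_sum: "(\<Sum>j<m. optimal_weight j) = 1"
proof -
  \<comment> \<open>The upper limit \<open>n\<close> is separated from \<open>m\<close> for the
    induction; at \<open>n = m\<close> the sum vanishes.\<close>
  have "(\<Sum>j<n. real m - 1 - 2 * real j) = real n * (real m - real n)" for n
    by (induction n) (simp_all add: algebra_simps)
  then have "(\<Sum>j<m. (real m - 1 - 2 * real j) / (1 + 2048 * (real m)\<^sup>2)) = 0"
    by (simp flip: sum_divide_distrib)
  then show ?thesis
    using m by (simp add: optimal_weight_def sum.distrib)
qed

lemma weight_minimizer: "j < m \<Longrightarrow> weight m \<eta> (score d \<eta> v minimizer) j = optimal_weight j"
proof -
  \<comment> \<open>Obtained by summing the desired equations
    \<open>score - \<nu> = \<eta> * optimal_weight j\<close> over \<open>j\<close>, the weights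
    having sum one.\<close>
  define \<nu> where "\<nu> = - (1 + 2048 * (real m)\<^sup>2) * \<eta> / real m - \<eta> * (real m - 1)"
  have pos: "0 < 1 + 2048 * (real m)\<^sup>2"
    by (simp add: add_pos_nonneg)
  have score: "score d \<eta> v minimizer j - \<nu> = \<eta> * optimal_weight j" if j: "j < m" for j
  proof -
    have "(1 + 2048 * (real m)\<^sup>2) * optimal_weight j = (1 + 2048 * (real m)\<^sup>2) / real m + (real m - 1 - 2 * real j)"
      using pos by (simp add: optimal_weight_def distrib_left)
    then have "\<eta> * ((1 + 2048 * (real m)\<^sup>2) * optimal_weight j)
        = \<eta> * ((1 + 2048 * (real m)\<^sup>2) / real m + (real m - 1 - 2 * real j))"
      by (rule arg_cong)
    moreover have "score d \<eta> v minimizer j = - (2048 * (real m)\<^sup>2 * \<eta>) * optimal_weight j - 2 * \<eta> * real j"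
      unfolding score_def minimizer_def orthonormal_d_sum(1)[OF orthonormal j] ..
    ultimately show ?thesis
      by (simp add: \<nu>_def algebra_simps add_divide_distrib diff_divide_distrib)
  qed
  then have max: "max 0 (score d \<eta> v minimizer j - \<nu>) = \<eta> * optimal_weight j" if "j < m" for j
    using optimal_weight_bounds(1)[OF that] that \<eta> by simp
  have "(\<Sum>j<m. max 0 (score d \<eta> v minimizer j - \<nu>)) = \<eta>"
    using optimal_weight_sum by (simp add: max flip: sum_distrib_left)
  then have "threshold m \<eta> (score d \<eta> v minimizer) = \<nu>"
    by (rule threshold_eqI[OF m \<eta>])
  then show "j < m \<Longrightarrow> weight m \<eta> (score d \<eta> v minimizer) j = optimal_weight j"
    using \<eta> by (simp add: weight_def max)
qed

lemma G_minimizer: "G minimizer = (\<lambda>_. 0)"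
proof
  fix i
  have "(\<Sum>j<m. (\<beta> * \<eta> / 2 * weight m \<eta> (score d \<eta> v minimizer) j) * v j i)
      = (\<Sum>j<m. (\<beta> * \<eta> / 2 * optimal_weight j) * v j i)"
    by (rule sum.cong) (simp_all add: weight_minimizer)
  also have "\<dots> = - (\<mu> * minimizer i)"
    using m by (simp add: minimizer_def sum_distrib_left mult_ac flip: sum_negf)
  finally show "G minimizer i = 0"
    by (simp add: hard_grad_def)
qed

text \<open>There are \<open>m\<close> orthonormal coefficients, each of size at most
  \<open>2049 * \<eta> * m\<close>, where \<open>2049 = 2048 * (1 + 1 / 2048)\<close>.\<close>

lemma norm_minimizer: "(norm_d d minimizer)\<^sup>2 \<le> (2049 * \<eta>)\<^sup>2 * real m ^ 3"
proof -
  have "(norm_d d minimizer)\<^sup>2 = (\<Sum>j<m. (- (2048 * (real m)\<^sup>2 * \<eta>) * optimal_weight j)\<^sup>2)"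
    unfolding minimizer_def by (rule orthonormal_d_sum(2)[OF orthonormal])
  also have "\<dots> \<le> (\<Sum>j<m. (2049 * \<eta> * real m)\<^sup>2)"
  proof (rule sum_mono)
    fix j assume "j \<in> {..<m}"
    then have j: "j < m" by simp
    have "2048 * (real m)\<^sup>2 * \<eta> * optimal_weight j \<le> 2048 * (real m)\<^sup>2 * \<eta> * ((1 + 1 / 2048) / real m)"
      using \<eta> by (intro mult_left_mono optimal_weight_bounds(2)[OF j]) simp
    also have "\<dots> = 2049 * \<eta> * real m"
      using m by (simp add: power2_eq_square)
    finally have "(2048 * (real m)\<^sup>2 * \<eta> * optimal_weight j)\<^sup>2 \<le> (2049 * \<eta> * real m)\<^sup>2"
      using \<eta> optimal_weight_bounds(1)[OF j] by (intro power_mono) simp_all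
    then show "(- (2048 * (real m)\<^sup>2 * \<eta>) * optimal_weight j)\<^sup>2 \<le> (2049 * \<eta> * real m)\<^sup>2"
      by simp
  qed
  also have "\<dots> = (2049 * \<eta>)\<^sup>2 * real m ^ 3"
    by (simp add: power_mult_distrib power2_eq_square power3_eq_cube)
  finally show ?thesis .
qed

lemma F_minimizer: "F minimizer + \<mu> / 2 * (norm_d d (\<lambda>i. y i - minimizer i))\<^sup>2 \<le> F y"
  using F_lower[of minimizer y] by (simp add: G_minimizer)

lemma global_minimizer_F: "global_minimizer d F z \<longleftrightarrow> z = minimizer"
proof
  have le: "F minimizer \<le> F y" for y
  proof -
    have "0 \<le> \<mu> / 2 * (norm_d d (\<lambda>i. y i - minimizer i))\<^sup>2"
      using \<mu>_pos by (intro mult_nonneg_nonneg) simp_all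
    then show ?thesis
      using F_minimizer[of y] by linarith
  qed
  show "z = minimizer \<Longrightarrow> global_minimizer d F z"
    by (simp add: global_minimizer_def minimizer_Rd le)
  assume "global_minimizer d F z"
  then have z: "z \<in> Rd d" "F z \<le> F minimizer"
    by (auto simp: global_minimizer_def minimizer_Rd)
  then have "\<mu> / 2 * (norm_d d (\<lambda>i. z i - minimizer i))\<^sup>2 \<le> 0"
    using F_minimizer[of z] by linarith
  then have "\<not> 0 < (norm_d d (\<lambda>i. z i - minimizer i))\<^sup>2"
    using mult_pos_pos[OF half_gt_zero[OF \<mu>_pos]] not_le by blast
  then have "norm_d d (\<lambda>i. z i - minimizer i) = 0"
    by simp
  then show "z = minimizer"
    using norm_d_eq_0_iff[OF Rd_closed(3)[OF z(1) minimizer_Rd]] by (simp add: fun_eq_iff)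
qed

lemma F_smooth_class:
  assumes "(2049 * \<eta>)\<^sup>2 * real m ^ 3 \<le> (R / 2)\<^sup>2" "0 < R"
  shows "F \<in> smooth_class \<beta> d R"
  unfolding smooth_class_def
proof (intro CollectI conjI ballI allI impI)
  show "convex_d d F"
  proof (rule convex_dI)
    fix x y
    have "0 \<le> \<mu> / 2 * (norm_d d (\<lambda>i. y i - x i))\<^sup>2"
      using \<mu>_pos by (intro mult_nonneg_nonneg) simp_all
    then show "F x + inner_d d (G x) (\<lambda>i. y i - x i) \<le> F y"
      using F_lower[of x y] by linarith
  qed
  have "continuous_map (Euclidean_space d) (Euclidean_space d) G"
    by (rule continuous_map_lipschitz_d[OF G_Rd G_lipschitz])
  then show "continuous_map (Euclidean_space d) (Euclidean_space d) (gradient d F)"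
    by (rule continuous_map_eq) (simp add: gradient_F)
  have "norm_d d minimizer \<le> R / 2"
    using assms(2) by (intro power2_le_imp_le[OF order_trans[OF norm_minimizer assms(1)]]) simp
  then show "z \<in> ball_d d (R / 2)" if "global_minimizer d F z" for z
    using that by (simp add: global_minimizer_F ball_d_def minimizer_Rd)
  show "\<exists>!z. global_minimizer d F z"
    unfolding global_minimizer_F by simp
qed (simp_all add: gradient_F has_gradient_F G_lipschitz)

text \<open>As \<open>m < d\<close>, some unit vector \<open>u\<close> is orthogonal to all
  \<open>v j\<close>. From the origin along \<open>u\<close> the scores stay constant, so
  \<open>F\<close> grows exactly like the quadratic.\<close>

lemma largest_modulus_F:
  assumes "m < d"
  shows "is_largest_strong_convexity_modulus d F \<mu>"
  unfolding is_largest_strong_convexity_modulus_def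
proof (intro conjI ballI)
  show "\<mu> \<in> strong_convexity_moduli d F"
    unfolding strong_convexity_moduli_def using \<mu>_pos F_lower by (simp add: gradient_F)
next
  fix \<nu> assume \<nu>: "\<nu> \<in> strong_convexity_moduli d F"
  have "card (v ` {..<m}) < d"
    using card_image_le[of "{..<m}" v] assms by simp
  then obtain u where u: "u \<in> Rd d" "inner_d d u u = 1" "\<And>s. s \<in> v ` {..<m} \<Longrightarrow> inner_d d s u = 0"
    using exists_orthogonal_unit_vector[of "v ` {..<m}" d] by auto
  have vu: "inner_d d (v j) u = 0" if "j < m" for j
    using u(3) that by simp
  have "smax m \<eta> (score d \<eta> v u) = smax m \<eta> (score d \<eta> v (\<lambda>_. 0))"
    using m by (intro smax_cong[OF m \<eta>, of 0]) (simp_all add: score_def vu)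
  then have "F u = F (\<lambda>_. 0) + \<mu> / 2"
    by (simp add: hard_fun_def norm_d_square u(2))
  moreover have "inner_d d (G (\<lambda>_. 0)) u = 0"
    by (simp add: inner_G vu)
  moreover have "F u \<ge> F (\<lambda>_. 0) + inner_d d (G (\<lambda>_. 0)) u + \<nu> / 2 * (norm_d d u)\<^sup>2"
  proof -
    have "F u \<ge> F (\<lambda>_. 0) + inner_d d (gradient d F (\<lambda>_. 0)) (\<lambda>i. u i - 0) + \<nu> / 2 * (norm_d d (\<lambda>i. u i - 0))\<^sup>2"
      using \<nu> u(1) Rd_closed(1) unfolding strong_convexity_moduli_def by blast
    then show ?thesis
      by (simp add: gradient_F Rd_closed)
  qed
  ultimately show "\<nu> \<le> \<mu>"
    by (simp add: norm_d_square u(2))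
qed

section \<open>The gap between the minimum and points orthogonal to one of the vectors\<close>

lemma min_value_F_le: "min_value d F \<le> - 512 * \<beta> * real m * \<eta>\<^sup>2"
proof -
  \<comment> \<open>Among points with all products equal to \<open>- t\<close>, the value
    \<open>t = 2048 * m * \<eta>\<close> minimizes \<open>- \<beta> * \<eta> * t / 2\<close> plus
    the quadratic part, which costs back half of the gain.\<close>
  define x where "x = (\<lambda>i. \<Sum>j<m. (- 2048 * real m * \<eta>) * v j i)"
  have x: "x \<in> Rd d"
    unfolding x_def using orthonormal by (intro Rd_closed) (simp add: orthonormal_d_def)
  have "smax m \<eta> (score d \<eta> v x) \<le> - 2048 * real m * \<eta>"
  proof (rule smax_le[OF m \<eta>])
    fix j assume "j < m"
    then have "inner_d d (v j) x = - 2048 * real m * \<eta>"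
      unfolding x_def by (rule orthonormal_d_sum(1)[OF orthonormal])
    then show "score d \<eta> v x j \<le> - 2048 * real m * \<eta>"
      using \<eta> by (simp add: score_def)
  qed
  then have "\<beta> * \<eta> / 2 * smax m \<eta> (score d \<eta> v x) \<le> \<beta> * \<eta> / 2 * (- 2048 * real m * \<eta>)"
    using \<beta> \<eta> by (intro mult_left_mono) simp_all
  also have "\<dots> = - 1024 * \<beta> * real m * \<eta>\<^sup>2"
    by (simp add: power2_eq_square)
  finally have "\<beta> * \<eta> / 2 * smax m \<eta> (score d \<eta> v x) \<le> - 1024 * \<beta> * real m * \<eta>\<^sup>2" .
  moreover have "bdd_below (F ` Rd d)"
    using global_minimizer_F[of minimizer] by (auto simp: global_minimizer_def intro!: bdd_belowI)
  then have "min_value d F \<le> F x"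
    unfolding min_value_def using x by (rule cINF_lower)
  moreover have "(norm_d d x)\<^sup>2 = real m * (- 2048 * real m * \<eta>)\<^sup>2"
    unfolding x_def orthonormal_d_sum(2)[OF orthonormal] by simp
  then have "\<beta> / (8192 * (real m)\<^sup>2) * (norm_d d x)\<^sup>2 = 512 * \<beta> * real m * \<eta>\<^sup>2"
    using m by (simp add: power_mult_distrib)
  ultimately show ?thesis
    unfolding hard_fun_def by linarith
qed

text \<open>Piece \<open>k\<close> alone keeps the smoothed maximum above
  \<open>- 2 * \<eta> * k - \<eta> / 2\<close>, and \<open>k + 1 \<le> m\<close>.\<close>

lemma F_ge:
  assumes "k < m" "inner_d d (v k) x = 0"
  shows "- \<beta> * real m * \<eta>\<^sup>2 \<le> F x"
proof -
  have "- 2 * real m * \<eta> \<le> - 2 * \<eta> * real k - \<eta> / 2"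
  proof -
    have "(real k + 1) * \<eta> \<le> real m * \<eta>"
      using assms(1) \<eta> by (intro mult_right_mono) auto
    then show ?thesis
      using \<eta> by (simp add: algebra_simps)
  qed
  also have "\<dots> \<le> smax m \<eta> (score d \<eta> v x)"
    using smax_ge[OF m \<eta> assms(1), of "score d \<eta> v x"] by (simp add: score_def assms(2))
  finally have "\<beta> * \<eta> / 2 * (- 2 * real m * \<eta>) \<le> \<beta> * \<eta> / 2 * smax m \<eta> (score d \<eta> v x)"
    using \<beta> \<eta> by (intro mult_left_mono) simp_all
  moreover have "\<beta> * \<eta> / 2 * (- 2 * real m * \<eta>) = - \<beta> * real m * \<eta>\<^sup>2"
    by (simp add: power2_eq_square)
  moreover have "0 \<le> \<beta> / (8192 * (real m)\<^sup>2) * (norm_d d x)\<^sup>2"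
    using \<beta> by (intro mult_nonneg_nonneg) simp_all
  ultimately show ?thesis
    unfolding hard_fun_def by linarith
qed

end

section \<open>The resisting oracle\<close>

text \<open>Agreement is asked only at the points queried in the run on \<open>f\<close>; by
  induction the run on \<open>g\<close> then queries the same points.\<close>

lemma history_cong:
  assumes "\<And>s. s < t \<Longrightarrow> f (Q s (history Q f s)) = g (Q s (history Q f s))"
  shows "history Q f t = history Q g t"
  using assms
proof (induction t)
  case (Suc t)
  then have "history Q f t = history Q g t"
    by simp
  then show ?case
    using Suc.prems[of t] by simp
qed simp

lemma history_update_later: "t \<le> T \<Longrightarrow> history (Q(T := q)) f t = history Q f t"
  by (induction t) simp_all

lemma history_in_space:
  assumes "algorithm d R T Q Qout" "t \<le> T"
  shows "history Q f t \<in> space (history_space d R t)"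
  using assms(2)
proof (induction t)
  case 0
  then show ?case
    by (simp add: history_space_def space_PiM)
next
  case (Suc t)
  then have h: "history Q f t \<in> space (history_space d R t)"
    by simp
  then have "Q t (history Q f t) \<in> space (query_space d R)"
    using assms(1) Suc.prems by (intro measurable_space[of "Q t"]) (auto simp: algorithm_def)
  then show ?case
    using h by (auto simp: history_space_def space_PiM space_pair_measure PiE_iff extensional_def)
qed

text \<open>The update \<open>Q(T := Qout)\<close> treats the output as query number
  \<open>T\<close>, so that the adversary handles queries and output uniformly.\<close>

lemma queries_in_ball:
  assumes "algorithm d R T Q Qout" "t \<le> T"
  shows "(Q(T := Qout)) t (history (Q(T := Qout)) f t) \<in> ball_d d R"
proof -
  have "(Q(T := Qout)) t \<in> history_space d R t \<rightarrow>\<^sub>M query_space d R"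
    using assms by (auto simp: algorithm_def)
  from measurable_space[OF this history_in_space[OF assms]] show ?thesis
    by (simp add: history_update_later[OF assms(2)] query_space_def space_restrict_space del: fun_upd_apply)
qed

text \<open>A zero vector stands for one not yet chosen. Either the new product vanishes too, or
  piece \<open>j\<close> lies \<eta> below piece \<open>p\<close> both before and after the change,
  and \<open>smax_cong\<close> applies.\<close>

lemma hard_fun_add_piece:
  assumes "0 < m" "0 < \<eta>" "j < m" "V j = (\<lambda>_. 0)"
    and "inner_d d u x = 0 \<or> (\<exists>p<j. inner_d d (V p) x = 0 \<and> inner_d d u x \<le> \<eta>)"
  shows "hard_fun d m \<beta> \<eta> (V(j := u)) x = hard_fun d m \<beta> \<eta> V x"
  using assms(5)
proof
  assume "inner_d d u x = 0"
  then have "score d \<eta> (V(j := u)) x = score d \<eta> V x"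
    using assms(4) by (auto simp: score_def)
  then show ?thesis
    by (simp add: hard_fun_def)
next
  assume "\<exists>p<j. inner_d d (V p) x = 0 \<and> inner_d d u x \<le> \<eta>"
  then obtain p where p: "p < j" "inner_d d (V p) x = 0" "inner_d d u x \<le> \<eta>"
    by blast
  have "\<eta> * (real p + 1) \<le> \<eta> * real j"
    using p(1) assms(2) by (intro mult_left_mono) auto
  then have "score d \<eta> V x j \<le> score d \<eta> V x p - \<eta>" "score d \<eta> (V(j := u)) x j \<le> score d \<eta> V x p - \<eta>"
    using p assms(2,4) by (simp_all add: score_def algebra_simps)
  moreover have "score d \<eta> (V(j := u)) x i = score d \<eta> V x i" if "i \<noteq> j" for i
    using that by (simp add: score_def)
  ultimately have "smax m \<eta> (score d \<eta> (V(j := u)) x) = smax m \<eta> (score d \<eta> V x)"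
    using p(1) assms(3) by (intro smax_cong[OF assms(1,2), of p]) (metis less_trans nat_neq_iff)+
  then show ?thesis
    by (simp add: hard_fun_def)
qed

text \<open>Time is cut into \<open>m\<close> phases of length \<open>K\<close>. Throughout phase \<open>j\<close> the vectors
  \<open>v\<^sub>0, \<dots>, v\<^sub>j\<^sub>-\<^sub>1\<close> are known and the oracle answers as if all later ones were \<open>0\<close>. At the end of the
  phase \<open>v\<^sub>j\<close> is chosen consistently with all these answers: orthogonal to the queries of phase \<open>j\<close>,
  and with so small a product with the earlier ones that piece \<open>j\<close> was inactive there.\<close>

lemma resisting_family:
  assumes m: "0 < m" and \<eta>: "0 < \<eta>" and R: "0 < R" and "0 < \<Lambda>" "0 < n"
    and dim: "m + K + n \<le> d" and card: "real (m * K) \<le> exp \<Lambda>" and small: "2 * R * sqrt (\<Lambda> / n) \<le> \<eta>"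
    and T: "T < m * K"
    and ball: "\<And>f t. t \<le> T \<Longrightarrow> Q t (history Q f t) \<in> ball_d d R"
  shows "\<exists>V. orthonormal_d d m V \<and>
    (\<forall>t\<le>T. inner_d d (V (t div K)) (Q t (history Q (hard_fun d m \<beta> \<eta> V) t)) = 0)"
proof -
  let ?x = "\<lambda>V t. Q t (history Q (hard_fun d m \<beta> \<eta> V) t)"
  \<comment> \<open>State after \<open>j\<close> phases: \<open>j\<close> vectors are fixed, the
    others are \<open>0\<close>, and each query so far is orthogonal to the vector of its own
    phase.\<close>
  have "\<exists>V. orthonormal_d d j V \<and> (\<forall>i\<ge>j. V i = (\<lambda>_. 0)) \<and>
      (\<forall>t\<le>T. t < j * K \<longrightarrow> inner_d d (V (t div K)) (?x V t) = 0)" if "j \<le> m" for j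
    using that
  proof (induction j)
    case 0
    show ?case
      by (intro exI[of _ "\<lambda>_ _. 0"]) (simp add: orthonormal_d_def)
  next
    case (Suc j)
    then obtain V where V: "orthonormal_d d j V" "\<And>i. j \<le> i \<Longrightarrow> V i = (\<lambda>_. 0)"
      "\<And>t. t \<le> T \<Longrightarrow> t < j * K \<Longrightarrow> inner_d d (V (t div K)) (?x V t) = 0"
      by auto
    \<comment> \<open>Exact orthogonality is imposed against known vectors and the queries of phase
      \<open>j\<close>, at most \<open>j + K\<close> constraints; the earlier queries, collected in
      \<open>P\<close>, get only the small-product bound.\<close>
    define S where "S = V ` {..<j} \<union> ?x V ` ({j * K..<Suc j * K} \<inter> {..T})"
    define P where "P = ?x V ` ({..<j * K} \<inter> {..T})"
    have "card (V ` {..<j}) \<le> j"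
      using card_image_le[of "{..<j}" V] by simp
    moreover have "card (?x V ` ({j * K..<Suc j * K} \<inter> {..T})) \<le> K"
      using card_image_le[of "{j * K..<Suc j * K} \<inter> {..T}" "?x V"]
        card_mono[of "{j * K..<Suc j * K}" "{j * K..<Suc j * K} \<inter> {..T}"] by simp
    ultimately have "card S \<le> j + K"
      unfolding S_def by (meson add_mono card_Un_le order_trans)
    then have S: "finite S" "card S + n \<le> d"
      using dim Suc.prems by (auto simp: S_def)
    have "card P \<le> j * K"
      using card_image_le[of "{..<j * K} \<inter> {..T}" "?x V"]
        card_mono[of "{..<j * K}" "{..<j * K} \<inter> {..T}"] by (simp add: P_def)
    also have "\<dots> \<le> m * K"
      using Suc.prems by (intro mult_le_mono1) simp
    finally have "real (card P) \<le> exp \<Lambda>"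
      using card by linarith
    moreover have "finite P" "\<And>x. x \<in> P \<Longrightarrow> norm_d d x \<le> R"
      using ball by (auto simp: P_def ball_d_def)
    ultimately obtain u where u: "u \<in> Rd d" "inner_d d u u = 1" "\<And>s. s \<in> S \<Longrightarrow> inner_d d s u = 0"
        "\<And>x. x \<in> P \<Longrightarrow> inner_d d u x \<le> 2 * R * sqrt (\<Lambda> / n)"
      using exists_unit_vector_small_products[OF S \<open>0 < n\<close> _ _ R _ \<open>0 < \<Lambda>\<close>] by metis
    define V' where "V' = V(j := u)"
    have late: "inner_d d u (?x V t) = 0" if "t \<le> T" "j * K \<le> t" "t < Suc j * K" for t
    proof -
      have "?x V t \<in> S"
        using that by (auto simp: S_def)
      then show ?thesis
        using u(3) inner_d_comm by metis
    qed
    have agree: "hard_fun d m \<beta> \<eta> V (?x V t) = hard_fun d m \<beta> \<eta> V' (?x V t)"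
      if t: "t \<le> T" "t < Suc j * K" for t
      unfolding V'_def
    proof (rule hard_fun_add_piece[OF m \<eta>, symmetric])
      show "inner_d d u (?x V t) = 0 \<or> (\<exists>p<j. inner_d d (V p) (?x V t) = 0 \<and> inner_d d u (?x V t) \<le> \<eta>)"
      proof (cases "t < j * K")
        case True
        then have "?x V t \<in> P"
          using t by (auto simp: P_def)
        then have "inner_d d u (?x V t) \<le> \<eta>"
          using u(4) small by (blast intro: order_trans)
        \<comment> \<open>The vector of the query's own phase, of index \<open>t div K < j\<close>,
          serves as the dominating piece \<open>p\<close>.\<close>
        then show ?thesis
          using V(3)[OF t(1) True] less_mult_imp_div_less[OF True] by blast
      qed (use late t in simp)
    qed (use V(2) Suc.prems in auto)
    \<comment> \<open>Choosing \<open>u\<close> in hindsight does not alter the run up to the end of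
      phase \<open>j\<close>.\<close>
    have x: "?x V' t = ?x V t" if "t \<le> T" "t < Suc j * K" for t
    proof -
      have "history Q (hard_fun d m \<beta> \<eta> V) t = history Q (hard_fun d m \<beta> \<eta> V') t"
        by (rule history_cong, rule agree) (use that in auto)
      then show ?thesis
        by simp
    qed
    have "inner_d d (V' (t div K)) (?x V' t) = 0" if t: "t \<le> T" "t < Suc j * K" for t
    proof (cases "t < j * K")
      case True
      then have "V' (t div K) = V (t div K)"
        using less_mult_imp_div_less[OF True] by (simp add: V'_def)
      then show ?thesis
        using V(3)[OF t(1) True] x[OF t] by simp
    next
      case False
      then have "t div K = j"
        using t(2) by (intro div_nat_eqI) (simp_all add: mult.commute)
      then show ?thesis
        using late[OF t(1) _ t(2)] False x[OF t] by (simp add: V'_def)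
    qed
    moreover have "orthonormal_d d (Suc j) V'"
    proof -
      have "inner_d d (V i) u = 0" "inner_d d u (V i) = 0" if "i < j" for i
        using u(3)[of "V i"] that by (auto simp: S_def inner_d_comm[of d u "V i"])
      then show ?thesis
        using V(1) u(1,2) by (auto simp: orthonormal_d_def less_Suc_eq V'_def)
    qed
    moreover have "\<forall>i\<ge>Suc j. V' i = (\<lambda>_. 0)"
      using V(2) by (simp add: V'_def)
    ultimately show ?case
      by blast
  qed
  \<comment> \<open>\<open>T < m * K\<close> places all times up to \<open>T\<close>, the output
    included, in one of the phases.\<close>
  from this[of m] show ?thesis
    using T by fastforce
qed

theorem theorem3p5:
  shows "\<exists>c0::real. c0 > 0 \<and> (\<exists>d0::nat.
    \<forall>(d::nat) (R::real) (\<beta>0::real) (m::nat).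
      d0 \<le> d \<and> 0 < R \<and> 0 < \<beta>0 \<and>
      1 \<le> m \<and> real m \<le> real d / 4 \<and>
      real m ^ 3 * ln (exp 1 * real d) \<le> c0 * real d \<longrightarrow>
      (\<forall>T Q Qout.
         algorithm d R T Q Qout \<and> real T < real d * real m / 8 \<longrightarrow>
         (\<exists>F \<in> smooth_class \<beta>0 d R.
            F (algorithm_output T Q Qout F) - min_value d F
              \<ge> 1 / 2 ^ 17 * (\<beta>0 * R\<^sup>2 / (real m)\<^sup>2) \<and>
            is_largest_strong_convexity_modulus d F (\<beta>0 / (4096 * (real m)\<^sup>2)))))"
\<comment> \<open>The constant \<open>9 / 2 ^ 32\<close> makes the product bound match
  \<open>\<eta>\<^sup>2\<close> after squaring; \<open>d \<ge> 8\<close> absorbs the rounding in the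
  phase length.\<close>
proof (intro exI[of _ "9 / 2 ^ 32 :: real"] exI[of _ "8 :: nat"] conjI allI impI, goal_cases)
  case 1
  show ?case
    by simp
next
  case (2 d R \<beta>0 m T Q Qout)
  then have d: "8 \<le> d" and R: "0 < R" and \<beta>: "0 < \<beta>0" and m: "0 < m" and md: "4 * m \<le> d"
    and log: "real m ^ 3 * ln (exp 1 * real d) \<le> 9 / 2 ^ 32 * real d"
    and alg: "algorithm d R T Q Qout" and T: "real T < real d * real m / 8"
    by auto
  \<comment> \<open>This is \<open>d / 8\<close> rounded up, so \<open>m\<close> phases outlast the
    budget, while at least \<open>d / 2\<close> dimensions remain for the random signs.\<close>
  define K where "K = (d + 7) div 8"
  define n where "n = d - m - K"
  \<comment> \<open>The lemma on small products is used with \<open>\<Lambda> = 2 * L\<close>, since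
    \<open>exp (2 * L) = (e d)^2\<close> bounds the number of queries.\<close>
  define L where "L = ln (exp 1 * real d)"
  \<comment> \<open>Scaled as \<open>R / m^(3/2)\<close> so that the minimizer lies in the ball of
    radius \<open>R / 2\<close>: \<open>2049^2 * 9 / 2^28\<close> is below
    \<open>1 / 4\<close>.\<close>
  define \<eta> where "\<eta> = 3 * R / (16384 * (real m * sqrt (real m)))"
  have K: "d \<le> 8 * K" "8 * K \<le> d + 7"
    unfolding K_def by simp_all
  have n: "d \<le> 2 * n" "m + K + n \<le> d"
    using d md K by (auto simp: n_def)
  have \<eta>: "0 < \<eta>"
    using R m by (simp add: \<eta>_def)
  have \<eta>2: "\<eta>\<^sup>2 = 9 * R\<^sup>2 / (2 ^ 28 * real m ^ 3)"
    by (simp add: \<eta>_def power_divide power_mult_distrib power3_eq_cube power2_eq_square)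
  have "1 \<le> L"
    using d by (simp add: L_def ln_mult)
  have "real (m * K) \<le> real (d * d)"
    unfolding of_nat_le_iff using md K d by (intro mult_le_mono) auto
  also have "\<dots> \<le> (exp 1 * real d) * (exp 1 * real d)"
    using mult_right_mono[of 1 "exp 1" "real d"] by (simp only: of_nat_mult) (intro mult_mono, simp_all)
  also have "\<dots> = exp (2 * L)"
    using d by (simp add: L_def exp_double power2_eq_square)
  finally have card: "real (m * K) \<le> exp (2 * L)" .
  have small: "2 * R * sqrt (2 * L / n) \<le> \<eta>"
  proof (rule power2_le_imp_le)
    have "2 * L / n \<le> 2 * L / (d / 2)"
      using n d \<open>1 \<le> L\<close> by (intro divide_left_mono) auto
    also have "\<dots> \<le> 4 * (9 / 2 ^ 32 / real m ^ 3)"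
    proof -
      have "L / d \<le> 9 / 2 ^ 32 / real m ^ 3"
        using log m d unfolding L_def[symmetric] by (simp add: field_simps)
      then show ?thesis
        by simp
    qed
    finally have "4 * R\<^sup>2 * (2 * L / n) \<le> 4 * R\<^sup>2 * (4 * (9 / 2 ^ 32 / real m ^ 3))"
      by (rule mult_left_mono) simp
    also have "\<dots> = \<eta>\<^sup>2"
      by (simp add: \<eta>2)
    finally show "(2 * R * sqrt (2 * L / n))\<^sup>2 \<le> \<eta>\<^sup>2"
      using \<open>1 \<le> L\<close> by (simp add: power_mult_distrib)
  qed (use \<eta> in simp)
  have TK: "T < m * K"
  proof -
    have "real d * real m / 8 \<le> real (m * K)"
      using mult_right_mono[of "real d" "8 * real K" "real m"] K(1) by (simp add: mult_ac)
    then show ?thesis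
      using T by linarith
  qed
  obtain V where V: "orthonormal_d d m V"
    "\<And>t. t \<le> T \<Longrightarrow> inner_d d (V (t div K))
      ((Q(T := Qout)) t (history (Q(T := Qout)) (hard_fun d m \<beta>0 \<eta> V) t)) = 0"
    using resisting_family[where Q = "Q(T := Qout)" and \<beta> = \<beta>0,
        OF m \<eta> R _ _ n(2) card small TK queries_in_ball[OF alg]]
      \<open>1 \<le> L\<close> n(1) d by auto
  interpret hard_instance d m \<beta>0 \<eta> V
    by unfold_locales (fact m \<eta> \<beta> V(1))+
  have \<eta>m: "\<eta>\<^sup>2 * real m ^ 3 = 9 * R\<^sup>2 / 2 ^ 28"
    using m by (simp add: \<eta>2)
  have "(2049 * \<eta>)\<^sup>2 * real m ^ 3 = 2049\<^sup>2 * (\<eta>\<^sup>2 * real m ^ 3)"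
    by (simp add: power_mult_distrib)
  also have "\<dots> \<le> (R / 2)\<^sup>2"
    by (simp add: \<eta>m power_divide)
  finally have "F \<in> smooth_class \<beta>0 d R"
    using R by (rule F_smooth_class)
  moreover have "1 / 2 ^ 17 * (\<beta>0 * R\<^sup>2 / (real m)\<^sup>2) \<le> F (algorithm_output T Q Qout F) - min_value d F"
  proof -
    have "inner_d d (V (T div K)) (algorithm_output T Q Qout F) = 0"
      using V(2)[of T] by (simp add: algorithm_output_def history_update_later)
    then have "- \<beta>0 * real m * \<eta>\<^sup>2 \<le> F (algorithm_output T Q Qout F)"
      using F_ge less_mult_imp_div_less[OF TK] by blast
    \<comment> \<open>Here \<open>511 = 512 - 1\<close> combines the two value bounds, and
      \<open>511 * 9 / 2^28\<close> exceeds \<open>2^(-17)\<close>.\<close>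
    then have "511 * (\<beta>0 * real m * \<eta>\<^sup>2) \<le> F (algorithm_output T Q Qout F) - min_value d F"
      using min_value_F_le by simp
    moreover have "\<beta>0 * real m * \<eta>\<^sup>2 = 9 / 2 ^ 28 * (\<beta>0 * R\<^sup>2 / (real m)\<^sup>2)"
      unfolding \<eta>2 using m by (simp add: power2_eq_square power3_eq_cube)
    moreover have "0 \<le> \<beta>0 * R\<^sup>2 / (real m)\<^sup>2"
      using \<beta> by simp
    ultimately show ?thesis
      by simp
  qed
  moreover have "is_largest_strong_convexity_modulus d F (\<beta>0 / (4096 * (real m)\<^sup>2))"
    using md m by (intro largest_modulus_F) simp
  ultimately show ?case
    by blast
qed

end
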